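(* Let $K$ be a totally real number field with ring of integers $\mathcal O$, let $\mathcal O^+$ be the set of totally positive elements of $\mathcal O$, let $\mathfrak a$ be an ideal of $\mathcal O$, and let $d\in\mathbb Z^+\cap\mathfrak a$ be a positive rational integer lying in $\mathfrak a$. Put $$S=\mathcal O^+\setminus\bigcup_{j=0}^{\infty}\left(\mathfrak a(d^j)\setminus(d^{j+1})\right),$$ where $(d^j)=d^j\mathcal O$ and $\mathfrak a(d^j)$ is the product ideal. Then, as formal power $q$-sums, $$\prod_{\delta\in\mathcal O^+,\ \delta\notin\mathfrak a}\frac{1}{1-q^{\delta}}=\prod_{\delta\in S}\left(1+q^{\delta}+q^{2\delta}+\cdots+q^{(d-1)\delta}\right).$$ Thus $p(''\mathcal O^+\setminus\mathfrak a'',\delta)=p(''S''(\le d-1),\delta)$ for all $\delta\in\mathcal O^+$.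
   Context: An element of $\mathcal O$ is totally positive if all its images under the embeddings $K\to\mathbb R$ are positive. A partition of $\delta\in\mathcal O^+$ is a finite sequence $(\lambda_1,\ldots,\lambda_k)$ (with $k$ not fixed) of elements of $\mathcal O^+$, called its parts, with $\lambda_1+\cdots+\lambda_k=\delta$; two partitions are identified if one is a reordering of the other. For $H\subset\mathcal O^+$, $p(''H'',\delta)$ is the number of partitions of $\delta$ all of whose parts lie in $H$, and for an integer $m\ge 0$, $p(''H''(\le m),\delta)$ is the number of partitions of $\delta$ all of whose parts lie in $H$ and in which no part appears more than $m$ times. Formal power $q$-sums: these are formal expressions $\sum_{\delta\in\mathcal O^+\cup\{0\}}c_\delta q^\delta$ with $c_\delta\in\mathbb R$ (no convergence is required), i.e. functions $\delta\mapsto c_\delta$ on $\mathcal O^+\cup\{0\}$. They are added coefficientwise and multiplied by $\left(\sum c_\delta q^\delta\right)\left(\sum d_\delta q^\delta\right)=\sum_{\gamma}\left(\sum_{\gamma=\alpha+\beta}c_\alpha d_\beta\right)q^\gamma$ with $\alpha,\beta\in\mathcal O^+\cup\{0\}$; the inner sum is finite because each $\gamma$ has only finitely many decompositions $\gamma=\alpha+\beta$ with $\alpha,\beta\in\mathcal O^+\cup\{0\}$. An infinite product $\prod_{i\in I}f_i(q)$ is defined as $\sum c_\delta q^\delta$ if for each $\delta\in\mathcal O^+\cup\{0\}$ there is a finite $I_\delta\subset I$ such that for every finite $J$ with $I_\delta\subset J\subset I$ the coefficient of $q^\delta$ in $\prod_{i\in J}f_i(q)$ equals that in $\prod_{i\in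 I_\delta}f_i(q)$; this common value is $c_\delta$. The notation $\prod_{\delta\in H}\frac1{1-q^\delta}$ means $\prod_{\delta\in H}(1+q^\delta+q^{2\delta}+\cdots)$. *)

theory Defs
  imports
    Complex_Main
    "HOL-Library.Multiset"
    "HOL-Algebra.FiniteProduct"
    "HOL-Algebra.Ideal_Product"
    "HOL-Algebra.Algebraic_Closure_Type"
begin

text \<open>
  The number field \<open>K\<close> is the universe of a type \<open>'k\<close> of class \<open>field_char_0\<close>; a constant that
  depends only on \<open>K\<close> takes the type as an argument. The library's \<open>ring_of_type_algebra\<close> turns such
  a type into a ring with explicit carrier, so that homomorphisms and ideals are those of
  HOL-Algebra.
\<close>

definition number_field :: "'k::field_char_0 itself \<Rightarrow> bool" where
  "number_field _ \<longleftrightarrow>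
     (\<exists>B::'k set. finite_dimensional_vector_space (\<lambda>(r::rat) x. of_rat r * x) B)"

definition embeddings :: "('k::field_char_0 \<Rightarrow> 'l::field_char_0) set" where
  "embeddings = ring_hom ring_of_type_algebra ring_of_type_algebra"

definition totally_real :: "'k::field_char_0 itself \<Rightarrow> bool" where
  "totally_real _ \<longleftrightarrow> (\<forall>\<sigma> \<in> (embeddings :: ('k \<Rightarrow> complex) set). range \<sigma> \<subseteq> \<real>)"

definition ring_of_integers :: "'k::field_char_0 ring" where
  "ring_of_integers = ring_of_type_algebra \<lparr>carrier := {x. algebraic_int x}\<rparr>"

definition totally_positive :: "'k::field_char_0 set" where
  "totally_positive =
     {x \<in> carrier ring_of_integers. \<forall>\<sigma> \<in> (embeddings :: ('k \<Rightarrow> real) set). \<sigma> x > 0}"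

text \<open>
  A partition, being a finite sequence up to reordering, is a multiset. For a totally real number
  field every \<open>\<delta>\<close> has only finitely many partitions, so \<open>card\<close> is the true count.
\<close>

definition partitions :: "'k::field_char_0 \<Rightarrow> 'k multiset set" where
  "partitions \<delta> = {\<Lambda>. set_mset \<Lambda> \<subseteq> totally_positive \<and> sum_mset \<Lambda> = \<delta>}"

definition num_partitions :: "'k::field_char_0 set \<Rightarrow> 'k \<Rightarrow> nat" where
  "num_partitions H \<delta> = card {\<Lambda> \<in> partitions \<delta>. set_mset \<Lambda> \<subseteq> H}"

definition num_partitions_le :: "'k::field_char_0 set \<Rightarrow> nat \<Rightarrow> 'k \<Rightarrow> nat" where
  "num_partitions_le H m \<delta> =
     card {\<Lambda> \<in> partitions \<delta>. set_mset \<Lambda> \<subseteq> H \<and> (\<forall>x. count \<Lambda> x \<le> m)}"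

text \<open>
  A formal \<open>q\<close>-sum is represented by its coefficient function, extended by zero outside
  \<open>insert 0 totally_positive\<close>. The sum defining the product is finite because a totally real
  number field has only finitely many decompositions of \<open>\<gamma>\<close>.
\<close>

definition qsum_ring :: "('k::field_char_0 \<Rightarrow> real) ring" where
  "qsum_ring = \<lparr>
     carrier = {c. \<forall>\<delta>. \<delta> \<notin> insert 0 totally_positive \<longrightarrow> c \<delta> = 0},
     monoid.mult = (\<lambda>c e \<gamma>. \<Sum>(\<alpha>, \<beta>) \<in> {(\<alpha>, \<beta>). \<alpha> \<in> insert 0 totally_positive \<and>
               \<beta> \<in> insert 0 totally_positive \<and> \<gamma> = \<alpha> + \<beta>}. c \<alpha> * e \<beta>),
     one = (\<lambda>\<delta>. if \<delta> = 0 then 1 else 0),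
     zero = (\<lambda>_. 0),
     add = (\<lambda>c e \<delta>. c \<delta> + e \<delta>)\<rparr>"

definition q_pow :: "'k::field_char_0 \<Rightarrow> 'k \<Rightarrow> real" where
  "q_pow \<delta> = (\<lambda>\<gamma>. if \<gamma> = \<delta> then 1 else 0)"

text \<open>
  \<open>1 + q\<^sup>\<delta> + q\<^sup>2\<^sup>\<delta> + \<dots>\<close>, for \<open>\<delta> \<noteq> 0\<close>: the exponents \<open>n\<delta>\<close> are then distinct, so every coefficient
  is 0 or 1.
\<close>

definition q_geom :: "'k::field_char_0 \<Rightarrow> 'k \<Rightarrow> real" where
  "q_geom \<delta> = (\<lambda>\<gamma>. if \<exists>n::nat. \<gamma> = of_nat n * \<delta> then 1 else 0)"

definition q_geom_upto :: "nat \<Rightarrow> 'k::field_char_0 \<Rightarrow> 'k \<Rightarrow> real" where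
  "q_geom_upto m \<delta> = (\<Oplus>\<^bsub>qsum_ring\<^esub>n\<in>{..m}. q_pow (of_nat n * \<delta>))"

text \<open>\<open>has_qprod f I c\<close>: the infinite product of the \<open>f i\<close>, \<open>i \<in> I\<close>, is defined and equals \<open>c\<close>.\<close>

definition has_qprod ::
    "('i \<Rightarrow> 'k::field_char_0 \<Rightarrow> real) \<Rightarrow> 'i set \<Rightarrow> ('k \<Rightarrow> real) \<Rightarrow> bool" where
  "has_qprod f I c \<longleftrightarrow> c \<in> carrier qsum_ring \<and>
     (\<forall>\<delta> \<in> insert 0 totally_positive. \<exists>I\<^sub>\<delta>. finite I\<^sub>\<delta> \<and> I\<^sub>\<delta> \<subseteq> I \<and>
        (\<Otimes>\<^bsub>qsum_ring\<^esub>i\<in>I\<^sub>\<delta>. f i) \<delta> = c \<delta> \<and>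
        (\<forall>J. finite J \<and> I\<^sub>\<delta> \<subseteq> J \<and> J \<subseteq> I \<longrightarrow>
           (\<Otimes>\<^bsub>qsum_ring\<^esub>i\<in>J. f i) \<delta> = (\<Otimes>\<^bsub>qsum_ring\<^esub>i\<in>I\<^sub>\<delta>. f i) \<delta>))"

end

theory Submission
  imports Defs
begin

text \<open>
  Write \<open>H\<close> for the set of totally positive integers outside \<open>\<aa>\<close> and suppose \<open>d \<ge> 2\<close>. As \<open>d \<in> \<aa>\<close>, the
  shifted sets \<open>d\<^sup>j H\<close> are pairwise disjoint: an equation \<open>d\<^sup>i y = d\<^sup>j y'\<close> with \<open>i < j\<close> would make \<open>y\<close> a
  multiple of \<open>d\<close>, hence an element of \<open>\<aa>\<close>. Their union is \<open>S\<close>: a totally positive \<open>x\<close> can be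
  written as \<open>d\<^sup>m y\<close> with \<open>m\<close> as large as possible, and \<open>x\<close> lies in one of the removed sets exactly
  when \<open>y \<in> \<aa>\<close>. The theorem is then Glaisher's bijection: expand the multiplicity \<open>n\<close> of each part
  \<open>y \<in> H\<close> in base \<open>d\<close> and replace the \<open>n\<close> copies of \<open>y\<close> by as many copies of each \<open>d\<^sup>j y\<close> as the
  \<open>j\<close>-th digit says. The sum does not change, every part now occurs at most \<open>d - 1\<close> times, and
  existence and uniqueness of base-\<open>d\<close> expansions make this a bijection
  (\<open>card_bounded_multiplicity\<close>). For \<open>d = 1\<close> the ideal is everything, \<open>H\<close> is empty and no part of
  \<open>S\<close> may be used, so that both sides are \<open>1\<close>.

  For the \<open>q\<close>-sums, the coefficient of \<open>q\<^sup>\<gamma>\<close> in a finite product of full or truncated geometric series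
  is a number of partitions of \<open>\<gamma>\<close> with restricted parts and multiplicities (\<open>finprod_geom\<close>), and
  only the finitely many factors indexed by parts of decompositions of \<open>\<gamma>\<close> affect it. So both infinite
  products exist, and the bijection shows that they agree.

  All of this rests on \<open>finite_decompositions\<close>: every \<open>\<gamma>\<close> is a sum of two elements that are totally
  positive or zero in only finitely many ways. The conjugates of such a summand are bounded by
  those of \<open>\<gamma>\<close>, its minimal polynomial over the rationals is monic with integer
  coefficients and has degree at most the dimension of the field, and there are only finitely many
  such polynomials with bounded roots. Here one needs that every complex root of the minimal
  polynomial of \<open>x\<close> is \<open>\<sigma> x\<close> for an embedding \<open>\<sigma>\<close> of the whole field
  (\<open>conjugate_is_embedding_image\<close>). Such a \<open>\<sigma>\<close> is built by adjoining first \<open>x\<close> and then the elements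
  of a basis one at a time, each time sending the new element to a root of its minimal polynomial.
  Finiteness is also what bounds the exponent \<open>m\<close> above: the elements \<open>x / d\<^sup>j\<close> that are integral all
  occur in decompositions of \<open>x\<close>.
\<close>

section \<open>Extending homomorphisms between fields\<close>

abbreviation ipoly :: "int poly \<Rightarrow> 'a::comm_ring_1 \<Rightarrow> 'a" where
  "ipoly P x \<equiv> poly (map_poly of_int P) x"

definition poly_on :: "'a::zero set \<Rightarrow> 'a poly \<Rightarrow> bool" where
  "poly_on F p \<longleftrightarrow> (\<forall>i. coeff p i \<in> F)"

text \<open>
  Rational subalgebras rather than subfields: when all elements are algebraic the two notions
  coincide by \<open>inverse_mem_subalgebra\<close> below, and closure under inverses need not be carried along.
\<close>

definition subalgebra_on :: "'a::field_char_0 set \<Rightarrow> bool" where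
  "subalgebra_on F \<longleftrightarrow> \<rat> \<subseteq> F \<and> (\<forall>a\<in>F. \<forall>b\<in>F. a + b \<in> F \<and> a * b \<in> F)"

definition hom_on :: "'a::field_char_0 set \<Rightarrow> ('a \<Rightarrow> 'b::field_char_0) \<Rightarrow> bool" where
  "hom_on F \<sigma> \<longleftrightarrow> \<sigma> 1 = 1 \<and> (\<forall>a\<in>F. \<forall>b\<in>F. \<sigma> (a + b) = \<sigma> a + \<sigma> b \<and> \<sigma> (a * b) = \<sigma> a * \<sigma> b)"

lemma subalgebra_onD:
  assumes "subalgebra_on F"
  shows "r \<in> \<rat> \<Longrightarrow> r \<in> F" "0 \<in> F" "1 \<in> F" "a \<in> F \<Longrightarrow> b \<in> F \<Longrightarrow> a + b \<in> F"
    "a \<in> F \<Longrightarrow> b \<in> F \<Longrightarrow> a * b \<in> F" "a \<in> F \<Longrightarrow> - a \<in> F" "a \<in> F \<Longrightarrow> b \<in> F \<Longrightarrow> a - b \<in> F"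
    "a \<in> F \<Longrightarrow> a ^ n \<in> F"
proof -
  have rat: "\<rat> \<subseteq> F" and cl: "\<And>a b. a \<in> F \<Longrightarrow> b \<in> F \<Longrightarrow> a + b \<in> F \<and> a * b \<in> F"
    using assms unfolding subalgebra_on_def by auto
  show "r \<in> \<rat> \<Longrightarrow> r \<in> F" "0 \<in> F" "1 \<in> F" "a \<in> F \<Longrightarrow> b \<in> F \<Longrightarrow> a + b \<in> F"
    "a \<in> F \<Longrightarrow> b \<in> F \<Longrightarrow> a * b \<in> F"
    using rat cl by auto
  have m1: "- 1 \<in> F" using rat by (meson Rats_1 Rats_minus_iff subset_iff)
  have neg: "- a \<in> F" if "a \<in> F" for a
    using cl[OF m1 that] by simp
  show "a \<in> F \<Longrightarrow> - a \<in> F" by (rule neg)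
  show "a \<in> F \<Longrightarrow> b \<in> F \<Longrightarrow> a - b \<in> F"
    using cl[of a "- b"] neg[of b] by simp
  show "a \<in> F \<Longrightarrow> a ^ n \<in> F"
    using rat cl by (induction n) auto
qed

lemma subalgebra_on_sum:
  assumes "subalgebra_on F" "\<And>i. i \<in> A \<Longrightarrow> f i \<in> F"
  shows "sum f A \<in> F"
  using assms(2) by (induction A rule: infinite_finite_induct) (auto simp: subalgebra_onD[OF assms(1)])

lemma hom_onD:
  assumes "hom_on F \<sigma>" "subalgebra_on F"
  shows "\<sigma> 1 = 1" "\<sigma> 0 = 0" "a \<in> F \<Longrightarrow> b \<in> F \<Longrightarrow> \<sigma> (a + b) = \<sigma> a + \<sigma> b"
    "a \<in> F \<Longrightarrow> b \<in> F \<Longrightarrow> \<sigma> (a * b) = \<sigma> a * \<sigma> b"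
proof -
  show "\<sigma> 1 = 1" and add: "\<And>a b. a \<in> F \<Longrightarrow> b \<in> F \<Longrightarrow> \<sigma> (a + b) = \<sigma> a + \<sigma> b"
    and "a \<in> F \<Longrightarrow> b \<in> F \<Longrightarrow> \<sigma> (a * b) = \<sigma> a * \<sigma> b"
    using assms(1) unfolding hom_on_def by blast+
  show "\<sigma> 0 = 0"
    using add[of 0 0] subalgebra_onD(2)[OF assms(2)] by simp
qed

lemma hom_on_sum:
  assumes "hom_on F \<sigma>" "subalgebra_on F" "\<And>i. i \<in> A \<Longrightarrow> f i \<in> F"
  shows "\<sigma> (sum f A) = (\<Sum>i\<in>A. \<sigma> (f i))"
  using assms(3)
proof (induction A rule: infinite_finite_induct)
  case (insert x A)
  then have "sum f A \<in> F" by (intro subalgebra_on_sum assms(2)) auto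
  with insert show ?case by (simp add: hom_onD(3)[OF assms(1,2)])
qed (use hom_onD[OF assms(1,2)] in auto)

lemma poly_on_closed:
  assumes F: "subalgebra_on F" and p: "poly_on F p"
  shows "poly_on F q \<Longrightarrow> poly_on F (p + q)" "poly_on F q \<Longrightarrow> poly_on F (p - q)"
    "poly_on F q \<Longrightarrow> poly_on F (p * q)" "c \<in> F \<Longrightarrow> poly_on F (smult c p)" "c \<in> F \<Longrightarrow> poly p c \<in> F"
  using p unfolding poly_on_def coeff_mult poly_altdef
  by (auto intro!: subalgebra_on_sum[OF F] simp: subalgebra_onD[OF F])

lemma poly_on_monom: "subalgebra_on F \<Longrightarrow> c \<in> F \<Longrightarrow> poly_on F (monom c n)"
  by (auto simp: poly_on_def subalgebra_onD(2))

lemma map_poly_hom_on: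
  assumes h: "hom_on F \<sigma>" and F: "subalgebra_on F" and p: "poly_on F p" and q: "poly_on F q"
  shows "map_poly \<sigma> (p + q) = map_poly \<sigma> p + map_poly \<sigma> q"
    and "map_poly \<sigma> (p * q) = map_poly \<sigma> p * map_poly \<sigma> q"
proof -
  note hD = hom_onD[OF h F]
  have in_F: "coeff p i \<in> F" "coeff q i \<in> F" for i
    using p q by (auto simp: poly_on_def)
  show "map_poly \<sigma> (p + q) = map_poly \<sigma> p + map_poly \<sigma> q"
    by (rule poly_eqI) (simp add: coeff_map_poly hD in_F)
  show "map_poly \<sigma> (p * q) = map_poly \<sigma> p * map_poly \<sigma> q"
    by (rule poly_eqI)
      (simp add: coeff_map_poly hD in_F coeff_mult hom_on_sum[OF h F] subalgebra_onD[OF F])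
qed

text \<open>
  A nonzero algebraic \<open>u\<close> satisfies an integer equation \<open>a + u \<cdot> Q(u) = 0\<close> with \<open>a \<noteq> 0\<close>, so its
  inverse \<open>- Q(u) / a\<close> is a polynomial in \<open>u\<close>.
\<close>

lemma inverse_mem_subalgebra:
  assumes F: "subalgebra_on F" and u: "u \<in> F" "algebraic u"
  shows "inverse u \<in> F"
proof (cases "u = 0")
  case False
  obtain P where P: "coeff P 0 \<noteq> 0" "ipoly P u = 0"
    using algebraicE'_nonzero[OF u(2) False] by blast
  obtain a Q where PQ: "P = pCons a Q" by (cases P)
  have a: "a \<noteq> 0" using P(1) PQ by simp
  have eq: "of_int a + u * ipoly Q u = 0"
    using P(2) PQ by (simp add: map_poly_pCons)
  have "poly_on F (map_poly of_int Q)"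
    by (auto simp: poly_on_def coeff_map_poly intro!: subalgebra_onD(1)[OF F])
  then have "ipoly Q u \<in> F" using poly_on_closed(5)[OF F _ u(1)] by blast
  moreover have "- (1 / of_int a) \<in> F"
    by (intro subalgebra_onD(1)[OF F]) auto
  ultimately have "- (1 / of_int a) * ipoly Q u \<in> F"
    by (rule subalgebra_onD(5)[OF F, rotated])
  moreover have "inverse u = - (1 / of_int a) * ipoly Q u"
    using eq a False by (simp add: field_simps eq_neg_iff_add_eq_0)
  ultimately show ?thesis by simp
qed (use subalgebra_onD[OF F] in auto)

text \<open>
  This makes the extension of \<open>\<sigma>\<close> that sends \<open>y\<close> to \<open>z\<close> well defined. It is polynomial division by the
  monic \<open>p\<close>, performed as an induction on the degree of \<open>q\<close>: subtracting a multiple of \<open>p\<close> that cancels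
  the leading term affects neither the vanishing of \<open>q\<close> at \<open>y\<close> nor the value of its image at \<open>z\<close>.
\<close>

lemma hom_kernel_minimal_poly:
  assumes F: "subalgebra_on F" and h: "hom_on F \<sigma>"
    and p: "poly_on F p" "lead_coeff p = 1"
    and min: "\<And>q. poly_on F q \<Longrightarrow> q \<noteq> 0 \<Longrightarrow> poly q y = 0 \<Longrightarrow> degree p \<le> degree q"
    and y: "poly p y = 0" and z: "poly (map_poly \<sigma> p) z = 0"
    and q: "poly_on F q" "poly q y = 0"
  shows "poly (map_poly \<sigma> q) z = 0"
  using q
proof (induction "if q = 0 then 0 else Suc (degree q)" arbitrary: q rule: less_induct)
  case less
  show ?case
  proof (cases "q = 0")
    case False
    define k where "k = degree q - degree p"
    define t where "t = monom (lead_coeff q) k"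
    define q' where "q' = q - t * p"
    have le: "degree p \<le> degree q" using min less.prems False by blast
    have tF: "poly_on F t"
      using less.prems(1) poly_on_monom[OF F] unfolding t_def poly_on_def by blast
    have tp: "poly_on F (t * p)" by (rule poly_on_closed(3)[OF F tF p(1)])
    have q'F: "poly_on F q'" unfolding q'_def by (rule poly_on_closed(2)[OF F less.prems(1) tp])
    have t0: "t \<noteq> 0" "p \<noteq> 0" using False p(2) by (auto simp: t_def)
    have degt: "degree (t * p) = degree q"
      using t0 le False by (simp add: degree_mult_eq t_def degree_monom_eq k_def)
    have "lead_coeff (t * p) = lead_coeff q"
      unfolding lead_coeff_mult using p(2) False by (simp add: t_def degree_monom_eq)
    then have "q' = 0 \<or> degree q' < degree q"
      unfolding q'_def using degt
      by (metis coeff_diff degree_diff_le eq_zero_or_degree_less order_refl right_minus_eq)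
    moreover have "poly q' y = 0" using y less.prems by (simp add: q'_def)
    ultimately have IH: "poly (map_poly \<sigma> q') z = 0"
      using less.hyps[of q'] q'F False by auto
    have "map_poly \<sigma> q = map_poly \<sigma> (q' + t * p)" by (simp add: q'_def)
    also have "\<dots> = map_poly \<sigma> q' + map_poly \<sigma> t * map_poly \<sigma> p"
      by (simp only: map_poly_hom_on[OF h F q'F tp] map_poly_hom_on[OF h F tF p(1)])
    finally show ?thesis using IH z by simp
  qed simp
qed

text \<open>
  The extension lives on the polynomial expressions in \<open>y\<close> with coefficients in \<open>F\<close>; a value
  \<open>q(y)\<close> is sent to \<open>(\<sigma> q)(z)\<close>, where the choice of \<open>q\<close> is immaterial by the previous lemma.
\<close>

lemma extend_hom_on:
  assumes F: "subalgebra_on F" and h: "hom_on F \<sigma>"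
    and p: "poly_on F p" "lead_coeff p = 1"
    and min: "\<And>q. poly_on F q \<Longrightarrow> q \<noteq> 0 \<Longrightarrow> poly q y = 0 \<Longrightarrow> degree p \<le> degree q"
    and y: "poly p y = 0" and z: "poly (map_poly \<sigma> p) z = 0"
  obtains F' \<sigma>' where "subalgebra_on F'" "hom_on F' \<sigma>'" "F \<subseteq> F'" "y \<in> F'"
    "\<And>a. a \<in> F \<Longrightarrow> \<sigma>' a = \<sigma> a" "\<sigma>' y = z"
proof -
  note FD = subalgebra_onD[OF F] and hD = hom_onD[OF h F]
  define F' where "F' = {poly q y | q. poly_on F q}"
  define \<sigma>' where "\<sigma>' w = poly (map_poly \<sigma> (SOME q. poly_on F q \<and> poly q y = w)) z" for w
  have \<sigma>': "\<sigma>' (poly q y) = poly (map_poly \<sigma> q) z" if q: "poly_on F q" for q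
  proof -
    define r where "r = (SOME r. poly_on F r \<and> poly r y = poly q y)"
    have r: "poly_on F r \<and> poly r y = poly q y"
      unfolding r_def by (rule someI[of _ q]) (use q in simp)
    have d: "poly_on F (r - q)" by (rule poly_on_closed(2)[OF F]) (use q r in auto)
    have "poly (map_poly \<sigma> (r - q)) z = 0"
      by (rule hom_kernel_minimal_poly[OF F h p min y z d]) (use r in auto)
    moreover have "map_poly \<sigma> r = map_poly \<sigma> ((r - q) + q)" by simp
    then have "map_poly \<sigma> r = map_poly \<sigma> (r - q) + map_poly \<sigma> q"
      by (simp only: map_poly_hom_on(1)[OF h F d q])
    ultimately show ?thesis by (simp add: \<sigma>'_def flip: r_def)
  qed
  have const: "poly_on F [:a:]" if "a \<in> F" for a
    using that FD(2) by (auto simp: poly_on_def coeff_pCons split: nat.splits)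
  have X: "poly_on F [:0, 1:]"
    using FD(2,3) by (auto simp: poly_on_def coeff_pCons split: nat.splits)
  have F_sub: "F \<subseteq> F'"
  proof
    fix a assume "a \<in> F"
    then show "a \<in> F'" using const[of a] unfolding F'_def
      by (intro CollectI exI[of _ "[:a:]"]) simp
  qed
  show thesis
  proof
    show "subalgebra_on F'"
      unfolding subalgebra_on_def
    proof safe
      fix r :: 'a assume "r \<in> \<rat>" then show "r \<in> F'" using F_sub FD(1) by blast
    next
      fix a b assume "a \<in> F'" "b \<in> F'"
      then obtain q r where "a = poly q y" "b = poly r y" "poly_on F q" "poly_on F r"
        by (auto simp: F'_def)
      then show "a + b \<in> F'" "a * b \<in> F'"
        unfolding F'_def using poly_on_closed(1)[OF F, of q r] poly_on_closed(3)[OF F, of q r]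
        by (metis (mono_tags, lifting) mem_Collect_eq poly_add poly_mult)+
    qed
    have one: "\<sigma>' 1 = 1"
      using \<sigma>'[OF const[OF FD(3)]] hD(1,2) by (simp add: map_poly_pCons)
    show "hom_on F' \<sigma>'"
      unfolding hom_on_def
    proof (intro conjI ballI one)
      fix a b assume "a \<in> F'" "b \<in> F'"
      then obtain q r where qr: "a = poly q y" "b = poly r y" "poly_on F q" "poly_on F r"
        by (auto simp: F'_def)
      show "\<sigma>' (a + b) = \<sigma>' a + \<sigma>' b"
        using \<sigma>'[OF poly_on_closed(1)[OF F qr(3,4)]] map_poly_hom_on(1)[OF h F qr(3,4)]
        by (simp add: qr(1,2) \<sigma>' qr(3,4))
      show "\<sigma>' (a * b) = \<sigma>' a * \<sigma>' b"
        using \<sigma>'[OF poly_on_closed(3)[OF F qr(3,4)]] map_poly_hom_on(2)[OF h F qr(3,4)]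
        by (simp add: qr(1,2) \<sigma>' qr(3,4))
    qed
    show "F \<subseteq> F'" by (rule F_sub)
    show "y \<in> F'" unfolding F'_def using X by (intro CollectI exI[of _ "[:0, 1:]"]) simp
    show "\<sigma>' a = \<sigma> a" if "a \<in> F" for a
      using \<sigma>'[OF const[OF that]] hD(2) by (simp add: map_poly_pCons)
    show "\<sigma>' y = z"
      using \<sigma>'[OF X] hD(1,2) by (simp add: map_poly_pCons)
  qed
qed

text \<open>
  A suitable root \<open>z\<close> exists because the complex numbers are algebraically closed.
\<close>

lemma extend_hom_on_algebraic:
  fixes F :: "'a::field_char_0 set" and \<sigma> :: "'a \<Rightarrow> complex"
  assumes F: "subalgebra_on F" and h: "hom_on F \<sigma>" and alg: "\<And>x::'a. algebraic x"
  obtains F' \<sigma>' where "subalgebra_on F'" "hom_on F' \<sigma>'" "F \<subseteq> F'" "y \<in> F'"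
    "\<And>a. a \<in> F \<Longrightarrow> \<sigma>' a = \<sigma> a"
proof -
  define Q where "Q q \<longleftrightarrow> poly_on F q \<and> q \<noteq> 0 \<and> poly q y = 0" for q
  obtain P :: "int poly" where P: "P \<noteq> 0" "ipoly P y = 0" using algebraicE'[OF alg] by blast
  have "Q (map_poly of_int P)"
    using P by (auto simp: Q_def poly_on_def coeff_map_poly map_poly_eq_0_iff intro!: subalgebra_onD(1)[OF F])
  then obtain m where m: "Q m" and min: "\<And>q. Q q \<Longrightarrow> degree m \<le> degree q"
    by (metis arg_min_natI arg_min_nat_le)
  define p where "p = smult (inverse (lead_coeff m)) m"
  have "lead_coeff m \<in> F" using m by (auto simp: Q_def poly_on_def)
  then have "inverse (lead_coeff m) \<in> F" by (rule inverse_mem_subalgebra[OF F _ alg])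
  then have p: "poly_on F p" "lead_coeff p = 1" "poly p y = 0" "degree p = degree m"
    using m poly_on_closed(4)[OF F] by (auto simp: Q_def p_def)
  have "degree p \<noteq> 0"
  proof
    assume "degree p = 0"
    then have "p = 1" using p(2) by (metis degree_eq_zeroE lead_coeff_pCons(2) one_pCons)
    with p(3) show False by simp
  qed
  have "lead_coeff (map_poly \<sigma> p) = 1 \<and> degree (map_poly \<sigma> p) = degree p"
    using p(2) hom_onD(1,2)[OF h F] by (simp add: map_poly_degree_eq coeff_map_poly)
  then have "\<not> constant (poly (map_poly \<sigma> p))"
    using \<open>degree p \<noteq> 0\<close> by (simp add: constant_degree)
  then obtain z where "poly (map_poly \<sigma> p) z = 0"
    using fundamental_theorem_of_algebra by blast
  then show thesis
    using extend_hom_on[OF F h p(1,2) _ p(3), of z] min p(4) that by (auto simp: Q_def)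
qed

section \<open>Minimal polynomials of algebraic integers\<close>

lemma clear_denominators:
  fixes q :: "'a::field_char_0 poly"
  assumes "poly_on \<rat> q"
  obtains c :: int and Q :: "int poly" where "c \<noteq> 0" "map_poly of_int Q = smult (of_int c) q"
proof -
  have "\<exists>c::int. c \<noteq> 0 \<and> (\<forall>i<n. of_int c * coeff q i \<in> \<int>)" for n
  proof (induction n)
    case (Suc n)
    then obtain c :: int where c: "c \<noteq> 0" "\<forall>i<n. of_int c * coeff q i \<in> \<int>" by blast
    obtain r where r: "coeff q n = of_rat r"
      using assms by (metis Rats_cases poly_on_def)
    obtain a b where ab: "r = of_int a / of_int b" "b > 0"
      by (metis quotient_of_div quotient_of_denom_pos surj_pair)
    have "of_int (c * b) * coeff q i \<in> \<int>" if "i < Suc n" for i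
    proof (cases "i = n")
      case True
      then have "of_int (c * b) * coeff q i = of_int (c * a)"
        using ab by (simp add: r of_rat_divide)
      then show ?thesis by (metis Ints_of_int)
    next
      case False
      then have "of_int c * coeff q i \<in> \<int>" using c(2) that by auto
      then have "of_int b * (of_int c * coeff q i) \<in> \<int>" by (rule Ints_mult[OF Ints_of_int])
      then show ?thesis by (simp add: mult_ac)
    qed
    then show ?case using c(1) ab(2) by (intro exI[of _ "c * b"]) auto
  qed (auto intro: exI[of _ 1])
  from this[of "Suc (degree q)"] obtain c :: int
    where c: "c \<noteq> 0" "\<forall>i<Suc (degree q). of_int c * coeff q i \<in> \<int>" by blast
  have "coeff (smult (of_int c) q) i \<in> \<int>" for i
    using c(2) by (cases "i < Suc (degree q)") (auto simp: coeff_eq_0)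
  then obtain Q where "smult (of_int c) q = map_poly of_int Q" by (metis intpolyE)
  then show thesis using that c(1) by metis
qed

text \<open>
  Gauss's lemma. A primitive integer polynomial \<open>P\<close> of least degree with root \<open>x\<close> divides, by
  pseudo-division and multiplicativity of contents, every integer polynomial with root \<open>x\<close>. Applied to
  a monic one, this shows that the leading coefficient of \<open>P\<close> is a unit. Clearing denominators carries
  the minimality over to polynomials with rational coefficients.
\<close>

lemma algebraic_int_minimal_poly:
  fixes x :: "'a::field_char_0"
  assumes "algebraic_int x"
  obtains P :: "int poly" where "lead_coeff P = 1" "ipoly P x = 0"
    "\<And>q. poly_on \<rat> q \<Longrightarrow> q \<noteq> 0 \<Longrightarrow> poly q x = 0 \<Longrightarrow> degree P \<le> degree q"
proof -
  obtain M :: "int poly" where M: "lead_coeff M = 1" "ipoly M x = 0"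
    using assms unfolding algebraic_int_altdef_ipoly by blast
  define Z where "Z Q \<longleftrightarrow> Q \<noteq> 0 \<and> ipoly Q x = 0" for Q
  have "Z M" using M by (auto simp: Z_def)
  then obtain R where R: "Z R" and min: "\<And>Q. Z Q \<Longrightarrow> degree R \<le> degree Q"
    by (metis arg_min_natI arg_min_nat_le)
  define P where "P = primitive_part R"
  have iadd: "map_poly of_int (A + B) = (map_poly of_int A + map_poly of_int B :: 'a poly)"
    and imul: "map_poly of_int (A * B) = (map_poly of_int A * map_poly of_int B :: 'a poly)"
    and ismult: "map_poly of_int (smult c A) = (smult (of_int c) (map_poly of_int A) :: 'a poly)"
    for A B c
    by (auto intro!: poly_eqI simp: coeff_map_poly coeff_mult)
  have P: "content P = 1" "degree P = degree R" "P \<noteq> 0" "ipoly P x = 0"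
  proof -
    show "content P = 1" "degree P = degree R" "P \<noteq> 0"
      using R by (auto simp: P_def Z_def)
    have "R = smult (content R) P" by (simp add: P_def)
    then have "ipoly R x = of_int (content R) * ipoly P x"
      by (metis ismult poly_smult)
    then show "ipoly P x = 0" using R by (auto simp: Z_def)
  qed
  have P_dvd: "P dvd Q" if Q: "ipoly Q x = 0" for Q
  proof -
    define r where "r = pseudo_mod Q P"
    obtain a q where aq: "a \<noteq> 0" "smult a Q = P * q + r"
      using pseudo_mod(1)[OF P(3)] unfolding r_def by blast
    have "of_int a * ipoly Q x = ipoly P x * ipoly q x + ipoly r x"
      using arg_cong[OF aq(2), of "\<lambda>t. ipoly t x"] by (simp add: iadd imul ismult)
    then have "ipoly r x = 0" using P(4) Q by simp
    then have "r = 0"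
      using pseudo_mod(2)[OF P(3), of Q] min[of r] P(2) unfolding Z_def r_def[symmetric] by linarith
    then have eq: "smult a Q = P * q" using aq(2) by simp
    \<comment> \<open>Since \<open>P\<close> is primitive, the factor \<open>a\<close> introduced by pseudo-division can be cancelled from \<open>q\<close>.\<close>
    then have "normalize a * content Q = content q"
      using P(1) content_mult[of P q] content_smult[of a Q] by (simp add: eq)
    then have "a dvd content q" by (metis dvd_normalize_iff dvd_triv_left normalize_dvd_iff)
    then have "[:a:] dvd q" by (simp add: const_poly_dvd_iff_dvd_content)
    then obtain s where "q = [:a:] * s" by (rule dvdE)
    then have "q = smult a s" by simp
    with eq have "smult a Q = smult a (P * s)" by simp
    then have "Q = P * s" using aq(1) by (simp add: poly_eq_iff)
    then show ?thesis by simp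
  qed
  have "lead_coeff P dvd 1"
  proof -
    obtain s where "M = P * s" using P_dvd[OF M(2)] by (rule dvdE)
    then have "lead_coeff P * lead_coeff s = 1" using M(1) by (simp only: lead_coeff_mult)
    then show ?thesis by (metis dvd_triv_left)
  qed
  define P' where "P' = smult (lead_coeff P) P"
  have lc: "lead_coeff P * lead_coeff P = 1"
    using \<open>lead_coeff P dvd 1\<close> by (auto simp: zdvd1_eq abs_if split: if_splits)
  show thesis
  proof
    show "lead_coeff P' = 1" using lc P(3) by (simp add: P'_def)
    show "ipoly P' x = 0" using P(4) by (simp add: P'_def ismult)
    fix q :: "'a poly" assume q: "poly_on \<rat> q" "q \<noteq> 0" "poly q x = 0"
    obtain c Q where cQ: "c \<noteq> 0" "map_poly of_int Q = smult (of_int c) q"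
      using clear_denominators[OF q(1)] .
    have "Z Q" using cQ q by (auto simp: Z_def)
    moreover have "degree Q = degree q"
      using arg_cong[OF cQ(2), of degree] cQ(1) by (simp add: degree_map_poly)
    ultimately show "degree P' \<le> degree q"
      using min[of Q] P(2) lc by (auto simp: P'_def)
  qed
qed

section \<open>Conjugates are images under embeddings\<close>

text \<open>
  Either two of the powers \<open>1, x, \<dots>, x\<^sup>n\<close>, with \<open>n\<close> the dimension, coincide, or they are \<open>n + 1\<close>
  distinct elements and hence linearly dependent over the rationals.
\<close>

lemma number_field_algebraic:
  fixes x :: "'k::field_char_0"
  assumes "finite_dimensional_vector_space (\<lambda>(r::rat) x::'k. of_rat r * x) B"
  obtains q where "poly_on \<rat> q" "q \<noteq> 0" "poly q x = 0" "degree q \<le> card B"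
proof -
  interpret finite_dimensional_vector_space "\<lambda>(r::rat) x::'k. of_rat r * x" B by fact
  obtain u :: "nat \<Rightarrow> 'k" where u: "\<And>i. u i \<in> \<rat>" "\<exists>i\<le>card B. u i \<noteq> 0" "(\<Sum>i\<le>card B. u i * x ^ i) = 0"
  proof (cases "inj_on (\<lambda>i. x ^ i) {..card B}")
    case True
    let ?S = "(\<lambda>i. x ^ i) ` {..card B}"
    have "card ?S = Suc (card B)" using card_image[OF True] by simp
    then have "dependent ?S"
      using independent_span_bound[OF finite_Basis, of ?S] by (auto simp: span_Basis)
    then obtain c v where c: "v \<in> ?S" "c v \<noteq> 0" "(\<Sum>v\<in>?S. of_rat (c v) * v) = 0"
      by (subst (asm) dependent_finite) auto
    have "(\<Sum>i\<le>card B. of_rat (c (x ^ i)) * x ^ i) = 0"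
      using c(3) by (subst (asm) sum.reindex[OF True]) simp
    with c show thesis by (intro that[of "\<lambda>i. of_rat (c (x ^ i))"]) auto
  next
    case False
    then obtain i j where ij: "i \<le> card B" "j \<le> card B" "i \<noteq> j" "x ^ i = x ^ j"
      by (auto simp: inj_on_def)
    define u where "u k = (if k = i then 1 else if k = j then - 1 else 0 :: 'k)" for k
    have "(\<Sum>k\<le>card B. u k * x ^ k) = (\<Sum>k\<in>{i, j}. u k * x ^ k)"
      by (rule sum.mono_neutral_right) (use ij in \<open>auto simp: u_def\<close>)
    also have "\<dots> = 0" using ij by (simp add: u_def)
    finally show thesis using ij by (intro that[of u]) (auto simp: u_def)
  qed
  define q where "q = (\<Sum>i\<le>card B. monom (u i) i)"
  have co: "coeff q k = (if k \<le> card B then u k else 0)" for k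
    by (auto simp: q_def coeff_sum)
  show thesis
  proof
    show "poly_on \<rat> q" using u(1) by (auto simp: poly_on_def co)
    show "q \<noteq> 0" using u(2) co by (metis coeff_0)
    show "poly q x = 0" using u(3) by (simp add: q_def poly_sum poly_monom)
    show "degree q \<le> card B" by (rule degree_le) (simp add: co)
  qed
qed

lemma algebraic_of_rat_poly: "poly_on \<rat> q \<Longrightarrow> q \<noteq> 0 \<Longrightarrow> poly q x = 0 \<Longrightarrow> algebraic x"
  by (rule algebraicI') (auto simp: poly_on_def)

lemma embeddings_iff:
  "\<sigma> \<in> embeddings \<longleftrightarrow> \<sigma> 1 = 1 \<and> (\<forall>a b. \<sigma> (a + b) = \<sigma> a + \<sigma> b \<and> \<sigma> (a * b) = \<sigma> a * \<sigma> b)"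
  by (auto simp: embeddings_def ring_hom_def ring_of_type_algebra_def)

text \<open>
  The inclusion of the rationals extends to a homomorphism with \<open>x \<mapsto> z\<close>, and then to every
  element of a basis in turn. A rational subalgebra that contains a basis is the whole field.
\<close>

lemma conjugate_is_embedding_image:
  fixes x :: "'k::field_char_0" and P :: "int poly" and z :: complex
  assumes B: "finite_dimensional_vector_space (\<lambda>(r::rat) x::'k. of_rat r * x) B"
    and P: "lead_coeff P = 1" "ipoly P x = 0"
    and min: "\<And>q. poly_on \<rat> q \<Longrightarrow> q \<noteq> 0 \<Longrightarrow> poly q x = 0 \<Longrightarrow> degree P \<le> degree q"
    and z: "ipoly P z = 0"
  obtains \<sigma> :: "'k \<Rightarrow> complex" where "\<sigma> \<in> embeddings" "\<sigma> x = z"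
proof -
  interpret finite_dimensional_vector_space "\<lambda>(r::rat) x::'k. of_rat r * x" B by fact
  have alg: "algebraic y" for y :: 'k
    using number_field_algebraic[OF B, of y] algebraic_of_rat_poly by metis
  define \<tau> :: "'k \<Rightarrow> complex" where "\<tau> a = of_rat (inv_into UNIV of_rat a)" for a
  have \<tau>: "\<tau> (of_rat r) = of_rat r" for r
    by (simp add: \<tau>_def inv_f_f inj_on_def)
  have Rats: "subalgebra_on (\<rat> :: 'k set)"
    by (auto simp: subalgebra_on_def)
  have hom: "hom_on \<rat> \<tau>"
    unfolding hom_on_def
  proof (intro conjI ballI)
    show "\<tau> 1 = 1" using \<tau>[of 1] by simp
    fix a b :: 'k assume "a \<in> \<rat>" "b \<in> \<rat>"
    then obtain r s where "a = of_rat r" "b = of_rat s" by (auto elim!: Rats_cases)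
    then show "\<tau> (a + b) = \<tau> a + \<tau> b" "\<tau> (a * b) = \<tau> a * \<tau> b"
      using \<tau>[of "r + s"] \<tau>[of "r * s"] by (simp_all add: \<tau> of_rat_add of_rat_mult)
  qed
  have \<tau>_int: "\<tau> (of_int n) = of_int n" for n using \<tau>[of "of_int n"] by simp
  have map: "map_poly \<tau> (map_poly of_int P) = map_poly of_int P"
    using \<tau>_int[of 0] by (intro poly_eqI) (simp add: coeff_map_poly \<tau>_int)
  have deg: "degree (map_poly of_int P :: 'k poly) = degree P"
    by (simp add: degree_map_poly)
  have lead: "lead_coeff (map_poly of_int P :: 'k poly) = 1"
    using P(1) by (simp add: deg coeff_map_poly)
  have Pon: "poly_on \<rat> (map_poly of_int P :: 'k poly)" by (auto simp: poly_on_def coeff_map_poly)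
  obtain F \<sigma> where F: "subalgebra_on F" "hom_on F \<sigma>" "x \<in> F" "\<sigma> x = z"
    using extend_hom_on[OF Rats hom Pon lead _ P(2), of z] min deg z map by metis
  have "\<exists>F' \<sigma>'. subalgebra_on F' \<and> hom_on F' \<sigma>' \<and> C \<subseteq> F' \<and> x \<in> F' \<and> \<sigma>' x = z" if "finite C" for C
    using that
  proof induction
    case empty
    show ?case using F by blast
  next
    case (insert c C)
    then obtain F' \<sigma>' where F': "subalgebra_on F'" "hom_on F' \<sigma>'" "C \<subseteq> F'" "x \<in> F'" "\<sigma>' x = z"
      by blast
    obtain F'' \<sigma>'' where "subalgebra_on F''" "hom_on F'' \<sigma>''" "F' \<subseteq> F''" "c \<in> F''"
      "\<And>a. a \<in> F' \<Longrightarrow> \<sigma>'' a = \<sigma>' a"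
      using extend_hom_on_algebraic[OF F'(1,2) alg] by blast
    then show ?case using F' by (intro exI[of _ F''] exI[of _ \<sigma>'']) auto
  qed
  from this[OF finite_Basis] obtain F' \<sigma>'
    where F': "subalgebra_on F'" "hom_on F' \<sigma>'" "B \<subseteq> F'" "\<sigma>' x = z" by blast
  have "subspace F'"
    unfolding subspace_def using subalgebra_onD[OF F'(1)] by (auto intro: Rats_of_rat)
  then have "F' = UNIV" using span_minimal[OF F'(3)] span_Basis by auto
  then have "\<sigma>' \<in> embeddings" using F'(2) by (simp add: embeddings_iff hom_on_def)
  then show thesis using that F'(4) by blast
qed

lemma embedding_zero: "\<sigma> \<in> embeddings \<Longrightarrow> \<sigma> 0 = 0"
  unfolding embeddings_iff by (metis add_cancel_right_right)

lemma embedding_of_nat: "\<sigma> \<in> embeddings \<Longrightarrow> \<sigma> (of_nat n) = of_nat n"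
  by (induction n) (auto simp: embeddings_iff embedding_zero)

lemma embedding_poly_root:
  fixes \<sigma> :: "'k::field_char_0 \<Rightarrow> 'l::field_char_0"
  assumes s: "\<sigma> \<in> embeddings" and "ipoly P x = 0"
  shows "ipoly P (\<sigma> x) = 0"
proof -
  have neg: "\<sigma> (- a) = - \<sigma> a" for a
    using s embedding_zero[OF s] unfolding embeddings_iff
    by (metis add.commute add.right_inverse eq_neg_iff_add_eq_0)
  have int: "\<sigma> (of_int n) = of_int n" for n
    by (cases n rule: int_diff_cases)
      (use s neg embedding_of_nat[OF s] in \<open>auto simp: embeddings_iff diff_conv_add_uminus simp del: add_uminus_conv_diff\<close>)
  have "\<sigma> (ipoly P x) = ipoly P (\<sigma> x)"
    by (induction P)
      (use s int embedding_zero[OF s] in \<open>auto simp: map_poly_pCons embeddings_iff\<close>)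
  then show ?thesis using assms embedding_zero[OF s] by simp
qed

section \<open>Finiteness of decompositions\<close>

text \<open>
  A monic polynomial of degree at most \<open>N\<close> is the product of its linear factors, so a bound on its
  roots bounds its values at \<open>0, \<dots>, N\<close>. These \<open>N + 1\<close> integers determine the polynomial.
\<close>

lemma finite_bounded_int_polys:
  "finite {P :: int poly. lead_coeff P = 1 \<and> degree P \<le> N \<and>
     (\<forall>z::complex. ipoly P z = 0 \<longrightarrow> norm z \<le> b)}" (is "finite ?A")
proof -
  define M where "M = (real N + \<bar>b\<bar> + 1) ^ N"
  define ev where "ev P = restrict (\<lambda>k. poly P (int k)) {..N}" for P :: "int poly"
  have "ev ` ?A \<subseteq> {..N} \<rightarrow>\<^sub>E {-\<lceil>M\<rceil>..\<lceil>M\<rceil>}"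
  proof (intro image_subsetI PiE_I)
    fix P k assume P: "P \<in> ?A" and k: "k \<in> {..N}"
    let ?P = "map_poly of_int P :: complex poly"
    have deg: "degree ?P = degree P" by (simp add: degree_map_poly)
    obtain rt where rt: "smult (lead_coeff ?P) (\<Prod>i<degree ?P. [:-rt i, 1:]) = ?P"
      by (rule complex_poly_decompose')
    have "lead_coeff ?P = 1" using P by (simp add: deg coeff_map_poly)
    with rt have rt: "?P = (\<Prod>i<degree P. [:-rt i, 1:])" by (simp add: deg)
    have root: "ipoly P (rt i) = 0" if "i < degree P" for i
      using that by (subst rt) (auto simp: poly_prod)
    have ev_hom: "ipoly P (of_int n :: complex) = of_int (poly P n)" for n
      by (induction P) (auto simp: map_poly_pCons)
    have "\<bar>real_of_int (poly P (int k))\<bar> = norm (ipoly P (of_int (int k) :: complex))"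
      unfolding ev_hom by simp
    also have "\<dots> = (\<Prod>i<degree P. norm (of_nat k - rt i))"
      by (subst rt) (simp add: poly_prod prod_norm)
    also have "\<dots> \<le> (\<Prod>i<degree P. real N + \<bar>b\<bar> + 1)"
    proof (rule prod_mono, intro conjI norm_ge_zero)
      fix i assume "i \<in> {..<degree P}"
      then have "norm (rt i) \<le> b" using root[of i] P by auto
      then show "norm (of_nat k - rt i) \<le> real N + \<bar>b\<bar> + 1"
        using norm_triangle_ineq4[of "of_nat k" "rt i"] k by simp
    qed
    also have "\<dots> \<le> M" using P by (auto simp: M_def intro!: power_increasing)
    finally have "\<bar>real_of_int (poly P (int k))\<bar> \<le> of_int \<lceil>M\<rceil>" by linarith
    then show "ev P k \<in> {-\<lceil>M\<rceil>..\<lceil>M\<rceil>}" using k by (auto simp: ev_def)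
  qed (auto simp: ev_def)
  then have "finite (ev ` ?A)" by (rule finite_subset) (auto intro: finite_PiE)
  moreover have "inj_on ev ?A"
  proof (rule inj_onI)
    fix P Q assume PQ: "P \<in> ?A" "Q \<in> ?A" "ev P = ev Q"
    have eq: "poly P (int k) = poly Q (int k)" if "k \<le> N" for k
      using fun_cong[OF PQ(3), of k] that by (simp add: ev_def)
    show "P = Q"
    proof (rule poly_eqI_degree)
      fix y assume "y \<in> int ` {..N}"
      then show "poly P y = poly Q y" using eq by auto
    next
      have "card (int ` {..N}) = Suc N" by (subst card_image) auto
      then show "degree P < card (int ` {..N})" "degree Q < card (int ` {..N})" using PQ by auto
    qed
  qed
  ultimately show ?thesis by (rule finite_imageD)
qed

text \<open>
  That the algebraic integers form a ring is part of what it means to have an ideal of them, which is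
  how this assumption is met in the theorem.
\<close>

locale totally_real_field =
  fixes K :: "'k::field_char_0 itself"
  assumes number_field: "number_field TYPE('k)"
    and totally_real: "totally_real TYPE('k)"
    and ring_of_integers_ring: "ring (ring_of_integers :: 'k ring)"
begin

abbreviation (input) integers :: "'k set" where "integers \<equiv> {x. algebraic_int x}"

lemma integers_closed:
  "x \<in> integers \<Longrightarrow> y \<in> integers \<Longrightarrow> x + y \<in> integers"
  "x \<in> integers \<Longrightarrow> y \<in> integers \<Longrightarrow> x * y \<in> integers"
  using ring.ring_simprules(1,5)[OF ring_of_integers_ring]
  by (auto simp: ring_of_integers_def ring_of_type_algebra_def)

text \<open>
  For a totally real field the minimal polynomial of \<open>x\<close> has this property, with \<open>N\<close> the dimension of the
  field.
\<close>

definition real_conjugates_poly :: "nat \<Rightarrow> 'k \<Rightarrow> int poly \<Rightarrow> bool" where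
  "real_conjugates_poly N x P \<longleftrightarrow> lead_coeff P = 1 \<and> degree P \<le> N \<and> ipoly P x = 0 \<and>
    (\<forall>z::complex. ipoly P z = 0 \<longrightarrow> (\<exists>\<sigma>\<in>(embeddings::('k \<Rightarrow> real) set). z = of_real (\<sigma> x)))"

lemma obtain_real_conjugates:
  obtains N where "\<And>x::'k. algebraic_int x \<Longrightarrow> \<exists>P. real_conjugates_poly N x P"
proof -
  obtain B where B: "finite_dimensional_vector_space (\<lambda>(r::rat) x::'k. of_rat r * x) B"
    using number_field unfolding number_field_def by blast
  have "\<exists>P. real_conjugates_poly (card B) x P"
    if x: "algebraic_int (x::'k)" for x
  proof -
    obtain P where P: "lead_coeff P = 1" "ipoly P x = 0"
      "\<And>q. poly_on \<rat> q \<Longrightarrow> q \<noteq> 0 \<Longrightarrow> poly q x = 0 \<Longrightarrow> degree P \<le> degree q"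
      using algebraic_int_minimal_poly[OF x] by blast
    have "degree P \<le> card B"
      using number_field_algebraic[OF B, of x] P(3) le_trans by metis
    moreover have "\<exists>\<sigma>\<in>(embeddings::('k \<Rightarrow> real) set). z = of_real (\<sigma> x)"
      if z: "ipoly P z = 0" for z :: complex
    proof -
      obtain \<sigma> :: "'k \<Rightarrow> complex" where \<sigma>: "\<sigma> \<in> embeddings" "\<sigma> x = z"
        using conjugate_is_embedding_image[OF B P z] .
      have real: "\<sigma> y = of_real (Re (\<sigma> y))" for y
        using totally_real \<sigma>(1) unfolding totally_real_def by (metis of_real_Re range_subsetD)
      have im: "Im (\<sigma> y) = 0" for y
        using real[of y] by (metis Im_complex_of_real)
      have "Re \<circ> \<sigma> \<in> embeddings"
        using \<sigma>(1) im unfolding embeddings_iff by simp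
      then show ?thesis using real[of x] \<sigma>(2) by (intro bexI[of _ "Re \<circ> \<sigma>"]) auto
    qed
    ultimately show ?thesis using P(1,2) unfolding real_conjugates_poly_def by blast
  qed
  then show thesis using that by blast
qed

text \<open>
  Send \<open>0\<close> to the root \<open>0\<close> of its own minimal polynomial.
\<close>

lemma real_embedding_exists: "\<exists>\<sigma>::'k \<Rightarrow> real. \<sigma> \<in> embeddings"
proof -
  obtain N where "\<And>x::'k. algebraic_int x \<Longrightarrow> \<exists>P. real_conjugates_poly N x P"
    using obtain_real_conjugates by blast
  from this[of 0] obtain P :: "int poly" where P: "ipoly P (0::'k) = 0"
    "\<And>z::complex. ipoly P z = 0 \<Longrightarrow> \<exists>\<sigma>. \<sigma>\<in>(embeddings::('k \<Rightarrow> real) set)"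
    unfolding real_conjugates_poly_def by (metis algebraic_int_0)
  have "poly P 0 = 0" using P(1) by (simp add: poly_0_coeff_0 coeff_map_poly)
  then have "ipoly P (0::complex) = 0" by (simp add: poly_0_coeff_0 coeff_map_poly)
  then show ?thesis using P(2) by blast
qed

lemma finite_bounded_conjugates:
  "finite {x::'k. algebraic_int x \<and> (\<forall>\<sigma>\<in>(embeddings::('k \<Rightarrow> real) set). \<bar>\<sigma> x\<bar> \<le> b)}"
proof -
  obtain N where N: "\<And>x::'k. algebraic_int x \<Longrightarrow> \<exists>P. real_conjugates_poly N x P"
    using obtain_real_conjugates by blast
  let ?A = "{P :: int poly. lead_coeff P = 1 \<and> degree P \<le> N \<and> (\<forall>z::complex. ipoly P z = 0 \<longrightarrow> norm z \<le> b)}"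
  have "finite (\<Union>P\<in>?A. {x::'k. ipoly P x = 0})"
    by (intro finite_UN_I finite_bounded_int_polys poly_roots_finite)
      (auto simp: map_poly_eq_0_iff)
  then show ?thesis
  proof (rule rev_finite_subset, safe)
    fix x :: 'k assume x: "algebraic_int x" "\<forall>\<sigma>\<in>(embeddings::('k \<Rightarrow> real) set). \<bar>\<sigma> x\<bar> \<le> b"
    then show "x \<in> (\<Union>P\<in>?A. {x::'k. ipoly P x = 0})"
      using N[OF x(1)] unfolding real_conjugates_poly_def by fastforce
  qed
qed

lemma totally_positive_iff:
  "x \<in> totally_positive \<longleftrightarrow> algebraic_int (x::'k) \<and> (\<forall>\<sigma>\<in>(embeddings::('k \<Rightarrow> real) set). \<sigma> x > 0)"
  by (auto simp: totally_positive_def ring_of_integers_def)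

lemma zero_not_totally_positive: "(0::'k) \<notin> totally_positive"
  using real_embedding_exists embedding_zero by (fastforce simp: totally_positive_iff)

lemma totally_positive_add:
  "x \<in> totally_positive \<Longrightarrow> y \<in> totally_positive \<Longrightarrow> x + (y::'k) \<in> totally_positive"
  using integers_closed(1)[of x y] by (auto simp: totally_positive_iff embeddings_iff intro!: add_pos_pos)

text \<open>
  The possible exponents of a formal \<open>q\<close>-sum.
\<close>

abbreviation (input) cone :: "'k set" where "cone \<equiv> insert 0 totally_positive"

lemma cone_add: "x \<in> cone \<Longrightarrow> y \<in> cone \<Longrightarrow> x + y \<in> cone"
  using totally_positive_add by auto

definition decompositions :: "'k \<Rightarrow> ('k \<times> 'k) set" where
  "decompositions \<gamma> = {(\<alpha>, \<beta>). \<alpha> \<in> cone \<and> \<beta> \<in> cone \<and> \<gamma> = \<alpha> + \<beta>}"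

lemma decompositions_iff:
  "(\<alpha>, \<beta>) \<in> decompositions \<gamma> \<longleftrightarrow> \<alpha> \<in> cone \<and> \<beta> \<in> cone \<and> \<gamma> = \<alpha> + \<beta>"
  unfolding decompositions_def by blast

lemma decompositions_outside: "\<gamma> \<notin> cone \<Longrightarrow> decompositions \<gamma> = {}"
  using cone_add unfolding decompositions_def by blast

text \<open>
  Under every real embedding both summands are nonnegative, so they are at most the image of \<open>\<gamma>\<close>,
  which is one of the finitely many real roots of a fixed polynomial with root \<open>\<gamma>\<close>.
\<close>

lemma finite_decompositions [simp]: "finite (decompositions \<gamma>)"
proof (cases "\<gamma> \<in> cone")
  case False
  then show ?thesis by (simp add: decompositions_outside)
next
  case True
  have "algebraic_int \<gamma>" using True by (auto simp: totally_positive_iff)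
  then obtain P where P: "P \<noteq> 0" "ipoly P \<gamma> = 0"
    using algebraic_int_imp_algebraic algebraicE' by metis
  define b where "b = Max (insert 0 {r::real. ipoly P r = 0})"
  have fin: "finite {r::real. ipoly P r = 0}"
    using P(1) by (intro poly_roots_finite) (auto simp: map_poly_eq_0_iff)
  let ?B = "{x::'k. algebraic_int x \<and> (\<forall>\<sigma>\<in>(embeddings::('k \<Rightarrow> real) set). \<bar>\<sigma> x\<bar> \<le> b)}"
  have bound: "\<alpha> \<in> ?B" if "\<alpha> \<in> cone" "\<beta> \<in> cone" "\<gamma> = \<alpha> + \<beta>" for \<alpha> \<beta>
  proof (intro CollectI conjI ballI)
    show "algebraic_int \<alpha>" using that by (auto simp: totally_positive_iff)
    fix \<sigma> :: "'k \<Rightarrow> real" assume \<sigma>: "\<sigma> \<in> embeddings"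
    have "0 \<le> \<sigma> x" if "x \<in> cone" for x
      using that \<sigma> embedding_zero[OF \<sigma>] by (auto simp: totally_positive_iff intro: less_imp_le)
    then have "0 \<le> \<sigma> \<alpha>" "0 \<le> \<sigma> \<beta>" using that by blast+
    moreover have "\<sigma> \<gamma> = \<sigma> \<alpha> + \<sigma> \<beta>" using \<sigma> that by (simp add: embeddings_iff)
    moreover have "\<sigma> \<gamma> \<le> b"
      unfolding b_def using fin embedding_poly_root[OF \<sigma> P(2)] by (intro Max_ge) auto
    ultimately show "\<bar>\<sigma> \<alpha>\<bar> \<le> b" by linarith
  qed
  have "decompositions \<gamma> \<subseteq> (\<lambda>\<alpha>. (\<alpha>, \<gamma> - \<alpha>)) ` ?B" using bound unfolding decompositions_def by force
  then show ?thesis by (rule finite_subset) (intro finite_imageI finite_bounded_conjugates)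
qed

end

section \<open>Products of geometric series count partitions\<close>

context totally_real_field
begin

lemma qsum_mult: "(c \<otimes>\<^bsub>qsum_ring\<^esub> e) \<gamma> = (\<Sum>(\<alpha>, \<beta>)\<in>decompositions \<gamma>. c \<alpha> * e (\<beta>::'k))"
  by (simp add: qsum_ring_def decompositions_def)

lemma qsum_one: "\<one>\<^bsub>qsum_ring\<^esub> = (\<lambda>\<delta>::'k. if \<delta> = 0 then 1 else 0)"
  by (simp add: qsum_ring_def)

lemma qsum_carrier: "c \<in> carrier qsum_ring \<longleftrightarrow> (\<forall>\<delta>::'k. \<delta> \<notin> cone \<longrightarrow> c \<delta> = 0)"
  by (simp add: qsum_ring_def)

text \<open>
  Associativity rearranges the sum over triples \<open>\<alpha> + \<beta> + \<beta>' = \<gamma>\<close>; the finiteness of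
  decompositions allows the double sums to be merged and split.
\<close>

lemma qsum_comm_monoid: "comm_monoid (qsum_ring :: ('k \<Rightarrow> real) ring)"
proof (rule comm_monoidI)
  fix c e g :: "'k \<Rightarrow> real"
  show "c \<otimes>\<^bsub>qsum_ring\<^esub> e \<in> carrier qsum_ring"
    by (simp add: qsum_carrier qsum_mult decompositions_outside)
  show "\<one>\<^bsub>qsum_ring\<^esub> \<in> carrier (qsum_ring :: ('k \<Rightarrow> real) ring)"
    by (simp add: qsum_carrier qsum_one)
  show "c \<otimes>\<^bsub>qsum_ring\<^esub> e = e \<otimes>\<^bsub>qsum_ring\<^esub> c"
  proof
    fix \<gamma>
    show "(c \<otimes>\<^bsub>qsum_ring\<^esub> e) \<gamma> = (e \<otimes>\<^bsub>qsum_ring\<^esub> c) \<gamma>"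
      unfolding qsum_mult
      by (rule sum.reindex_bij_witness[of _ prod.swap prod.swap])
        (auto simp: decompositions_def mult.commute add.commute)
  qed
  show "c \<otimes>\<^bsub>qsum_ring\<^esub> e \<otimes>\<^bsub>qsum_ring\<^esub> g = c \<otimes>\<^bsub>qsum_ring\<^esub> (e \<otimes>\<^bsub>qsum_ring\<^esub> g)"
  proof
    fix \<gamma>
    have "(c \<otimes>\<^bsub>qsum_ring\<^esub> e \<otimes>\<^bsub>qsum_ring\<^esub> g) \<gamma>
      = (\<Sum>p\<in>decompositions \<gamma>. \<Sum>q\<in>decompositions (fst p). c (fst q) * e (snd q) * g (snd p))"
      by (simp add: qsum_mult case_prod_beta sum_distrib_right)
    also have "\<dots> = (\<Sum>(p, q)\<in>(SIGMA p:decompositions \<gamma>. decompositions (fst p)).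
        c (fst q) * e (snd q) * g (snd p))"
      by (rule sum.Sigma) auto
    also have "\<dots> = (\<Sum>(p, q)\<in>(SIGMA p:decompositions \<gamma>. decompositions (snd p)).
        c (fst p) * (e (fst q) * g (snd q)))"
      by (rule sum.reindex_bij_witness[of _
            "\<lambda>(p, q). ((fst p + fst q, snd q), (fst p, fst q))"
            "\<lambda>(p, q). ((fst q, snd q + snd p), (snd q, snd p))"])
        (auto simp: decompositions_iff add.assoc mult.assoc totally_positive_add)
    also have "\<dots> = (\<Sum>p\<in>decompositions \<gamma>. \<Sum>q\<in>decompositions (snd p). c (fst p) * (e (fst q) * g (snd q)))"
      by (rule sum.Sigma[symmetric]) auto
    also have "\<dots> = (c \<otimes>\<^bsub>qsum_ring\<^esub> (e \<otimes>\<^bsub>qsum_ring\<^esub> g)) \<gamma>"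
      by (simp add: qsum_mult case_prod_beta sum_distrib_left)
    finally show "(c \<otimes>\<^bsub>qsum_ring\<^esub> e \<otimes>\<^bsub>qsum_ring\<^esub> g) \<gamma> = (c \<otimes>\<^bsub>qsum_ring\<^esub> (e \<otimes>\<^bsub>qsum_ring\<^esub> g)) \<gamma>" .
  qed
  assume c: "c \<in> carrier qsum_ring"
  show "\<one>\<^bsub>qsum_ring\<^esub> \<otimes>\<^bsub>qsum_ring\<^esub> c = c"
  proof
    fix \<gamma>
    show "(\<one>\<^bsub>qsum_ring\<^esub> \<otimes>\<^bsub>qsum_ring\<^esub> c) \<gamma> = c \<gamma>"
    proof (cases "\<gamma> \<in> cone")
      case True
      have "(\<one>\<^bsub>qsum_ring\<^esub> \<otimes>\<^bsub>qsum_ring\<^esub> c) \<gamma> = (\<Sum>p\<in>decompositions \<gamma>. if p = (0, \<gamma>) then c \<gamma> else 0)"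
        unfolding qsum_mult by (rule sum.cong) (auto simp: qsum_one decompositions_iff split: if_splits)
      then show ?thesis using True by (simp add: decompositions_iff)
    qed (use c in \<open>simp add: qsum_mult qsum_carrier decompositions_outside\<close>)
  qed
qed

lemma qsum_abelian_monoid: "abelian_monoid (qsum_ring :: ('k \<Rightarrow> real) ring)"
  by (rule abelian_monoidI) (auto simp: qsum_ring_def add_ac)

lemma finsum_qsum:
  assumes "finite A" "\<And>a. a \<in> A \<Longrightarrow> f a \<in> carrier qsum_ring"
  shows "(\<Oplus>\<^bsub>qsum_ring\<^esub>a\<in>A. f a) = (\<lambda>\<gamma>::'k. \<Sum>a\<in>A. f a \<gamma>)"
proof -
  interpret abelian_monoid "qsum_ring :: ('k \<Rightarrow> real) ring" by (rule qsum_abelian_monoid)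
  show ?thesis using assms
  proof (induction A)
    case empty
    show ?case by (simp add: finsum_empty) (simp add: qsum_ring_def)
  next
    case (insert a A)
    then have "(\<Oplus>\<^bsub>qsum_ring\<^esub>a\<in>insert a A. f a) = f a \<oplus>\<^bsub>qsum_ring\<^esub> (\<Oplus>\<^bsub>qsum_ring\<^esub>a\<in>A. f a)"
      by (intro finsum_insert) auto
    with insert show ?case by (simp add: qsum_ring_def)
  qed
qed

text \<open>
  Both kinds of factors at once: \<open>A\<close> is the set of admitted multiplicities of the part \<open>\<delta>\<close>, all
  of them for the full geometric series and \<open>{..m}\<close> for the truncated one.
\<close>

definition geom :: "nat set \<Rightarrow> 'k \<Rightarrow> 'k \<Rightarrow> real" where
  "geom A \<delta> = (\<lambda>\<gamma>. if \<exists>n\<in>A. \<gamma> = of_nat n * \<delta> then 1 else 0)"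

lemma of_nat_mult_cone: "\<delta> \<in> cone \<Longrightarrow> of_nat n * \<delta> \<in> cone"
proof (induction n)
  case (Suc n)
  then show ?case using cone_add[of \<delta> "of_nat n * \<delta>"] by (simp only: of_nat_Suc distrib_right mult_1)
qed simp

lemma geom_carrier:
  assumes "\<delta> \<in> totally_positive"
  shows "geom A \<delta> \<in> carrier qsum_ring"
proof -
  have "of_nat n * \<delta> \<in> cone" for n
    by (rule of_nat_mult_cone) (use assms in simp)
  then have "\<not> (\<exists>n\<in>A. \<gamma> = of_nat n * \<delta>)" if "\<gamma> \<notin> cone" for \<gamma>
    using that by blast
  then show ?thesis unfolding qsum_carrier geom_def by (intro allI impI if_not_P)
qed

lemma q_geom_eq: "q_geom = geom UNIV"
  by (simp add: q_geom_def geom_def fun_eq_iff)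

lemma q_geom_upto_eq:
  assumes "\<delta> \<in> totally_positive"
  shows "q_geom_upto m \<delta> = geom {..m} \<delta>"
proof
  fix \<gamma>
  have "\<delta> \<noteq> 0" using assms zero_not_totally_positive by blast
  have "q_geom_upto m \<delta> \<gamma> = (\<Sum>n\<le>m. q_pow (of_nat n * \<delta>) \<gamma>)"
    unfolding q_geom_upto_def using of_nat_mult_cone[of \<delta>] assms
    by (subst finsum_qsum) (auto simp: qsum_carrier q_pow_def)
  also have "\<dots> = geom {..m} \<delta> \<gamma>"
  proof (cases "\<exists>k\<le>m. \<gamma> = of_nat k * \<delta>")
    case True
    then obtain k where k: "k \<le> m" "\<gamma> = of_nat k * \<delta>" by blast
    have "(\<Sum>n\<le>m. q_pow (of_nat n * \<delta>) \<gamma>) = (\<Sum>n\<le>m. if n = k then 1 else 0)"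
      by (rule sum.cong) (use k \<open>\<delta> \<noteq> 0\<close> in \<open>auto simp: q_pow_def\<close>)
    then show ?thesis using True k(1) by (auto simp: geom_def)
  qed (auto simp: geom_def q_pow_def)
  finally show "q_geom_upto m \<delta> \<gamma> = geom {..m} \<delta> \<gamma>" .
qed

lemma sum_mset_cone: "set_mset \<Lambda> \<subseteq> cone \<Longrightarrow> sum_mset \<Lambda> \<in> cone"
proof (induction \<Lambda>)
  case (add x \<Lambda>)
  then have "x \<in> cone" "sum_mset \<Lambda> \<in> cone" by auto
  then show ?case using cone_add by (simp del: insert_iff)
qed simp

lemma part_decomposition:
  assumes "\<Lambda> \<in> partitions \<gamma>" "x \<in># \<Lambda>"
  shows "x \<in> fst ` decompositions \<gamma>"
proof -
  define \<Omega> where "\<Omega> = \<Lambda> - {#x#}"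
  have \<Lambda>: "\<Lambda> = add_mset x \<Omega>" using assms(2) by (simp add: \<Omega>_def)
  have "set_mset \<Omega> \<subseteq> cone" "x \<in> cone" "\<gamma> = x + sum_mset \<Omega>"
    using assms(1) by (auto simp: partitions_def \<Lambda>)
  then have "(x, sum_mset \<Omega>) \<in> decompositions \<gamma>"
    unfolding decompositions_iff using sum_mset_cone by blast
  then show ?thesis by (rule image_eqI[rotated]) simp
qed

text \<open>
  The parts of a partition of \<open>\<gamma>\<close> come from the finite set of parts of decompositions of \<open>\<gamma>\<close>. Under a real
  embedding they are bounded below by some \<open>c > 0\<close>, so that there are at most \<open>\<sigma> \<gamma> / c\<close> of them.
\<close>

lemma finite_partitions: "finite (partitions (\<gamma>::'k))"
proof -
  obtain \<sigma> :: "'k \<Rightarrow> real" where \<sigma>: "\<sigma> \<in> embeddings" using real_embedding_exists by blast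
  define P where "P = fst ` decompositions \<gamma> \<inter> totally_positive"
  have P: "finite P" by (simp add: P_def)
  \<comment> \<open>The element \<open>1\<close> only keeps the set nonempty.\<close>
  define c where "c = Min (insert 1 (\<sigma> ` P))"
  have c: "c > 0" "\<And>x. x \<in> P \<Longrightarrow> c \<le> \<sigma> x"
    using P \<sigma> by (auto simp: c_def P_def totally_positive_iff)
  have bound: "c * size \<Lambda> \<le> \<sigma> (sum_mset \<Lambda>)" if "set_mset \<Lambda> \<subseteq> P" for \<Lambda>
    using that
    by (induction \<Lambda>)
      (use \<sigma> c(2) embedding_zero[OF \<sigma>] in \<open>auto simp: embeddings_iff distrib_left intro!: add_mono\<close>)
  have "partitions \<gamma> \<subseteq> mset ` {xs. set xs \<subseteq> P \<and> length xs \<le> nat \<lfloor>\<sigma> \<gamma> / c\<rfloor>}"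
  proof
    fix \<Lambda> assume \<Lambda>: "\<Lambda> \<in> partitions \<gamma>"
    then have "set_mset \<Lambda> \<subseteq> P" using part_decomposition by (auto simp: P_def partitions_def)
    moreover from bound[OF this] have "size \<Lambda> \<le> nat \<lfloor>\<sigma> \<gamma> / c\<rfloor>"
      using \<Lambda> c(1) by (simp add: partitions_def le_nat_floor field_simps)
    moreover obtain xs where "\<Lambda> = mset xs" by (metis ex_mset)
    ultimately show "\<Lambda> \<in> mset ` {xs. set xs \<subseteq> P \<and> length xs \<le> nat \<lfloor>\<sigma> \<gamma> / c\<rfloor>}" by auto
  qed
  then show ?thesis by (rule finite_subset) (intro finite_imageI finite_lists_length_le P)
qed

definition parts_in :: "nat set \<Rightarrow> 'k set \<Rightarrow> 'k \<Rightarrow> 'k multiset set" where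
  "parts_in A H \<gamma> = {\<Lambda> \<in> partitions \<gamma>. set_mset \<Lambda> \<subseteq> H \<and> (\<forall>x. count \<Lambda> x \<in> A)}"

lemma finite_parts_in [simp]: "finite (parts_in A H \<gamma>)"
  by (rule finite_subset[OF _ finite_partitions[of \<gamma>]]) (auto simp: parts_in_def)

text \<open>
  Sorting partitions by the multiplicity of \<open>x\<close>: a partition with \<open>n\<close> copies of \<open>x\<close> corresponds to
  the decomposition of \<open>\<gamma>\<close> into \<open>n x\<close> and \<open>\<beta>\<close> together with a partition of \<open>\<beta>\<close> without \<open>x\<close>. This is the rule
  for multiplying by one more factor.
\<close>

lemma parts_in_insert:
  assumes x: "x \<in> totally_positive" "x \<notin> J" "0 \<in> A"
  shows "card (parts_in A (insert x J) \<gamma>)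
    = (\<Sum>(\<alpha>, \<beta>)\<in>decompositions \<gamma>. if \<exists>n\<in>A. \<alpha> = of_nat n * x then card (parts_in A J \<beta>) else 0)"
proof -
  have x0: "x \<noteq> 0" using x(1) zero_not_totally_positive by blast
  define D where "D = {p \<in> decompositions \<gamma>. \<exists>n\<in>A. fst p = of_nat n * x}"
  have "(\<Sum>(\<alpha>, \<beta>)\<in>decompositions \<gamma>. if \<exists>n\<in>A. \<alpha> = of_nat n * x then card (parts_in A J \<beta>) else 0)
    = (\<Sum>p\<in>D. card (parts_in A J (snd p)))"
    unfolding D_def by (subst sum.inter_filter) (auto simp: case_prod_beta)
  also have "\<dots> = card (SIGMA p:D. parts_in A J (snd p))"
    by (rule card_SigmaI[symmetric]) (auto simp: D_def)
  also have "\<dots> = card (parts_in A (insert x J) \<gamma>)"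
  proof (rule bij_betw_same_card[symmetric, OF bij_betwI'])
    define f where "f \<Lambda> =
      ((of_nat (count \<Lambda> x) * x, sum_mset (filter_mset ((\<noteq>) x) \<Lambda>)), filter_mset ((\<noteq>) x) \<Lambda>)"
      for \<Lambda> :: "'k multiset"
    have split: "\<Lambda> = replicate_mset (count \<Lambda> x) x + filter_mset ((\<noteq>) x) \<Lambda>"
      for \<Lambda> :: "'k multiset"
      by (rule multiset_eqI) (auto simp: count_eq_zero_iff)
    show "f \<Lambda> = f \<Lambda>' \<longleftrightarrow> \<Lambda> = \<Lambda>'" for \<Lambda> \<Lambda>'
    proof
      assume "f \<Lambda> = f \<Lambda>'"
      then have "count \<Lambda> x = count \<Lambda>' x" "filter_mset ((\<noteq>) x) \<Lambda> = filter_mset ((\<noteq>) x) \<Lambda>'"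
        using x0 by (auto simp: f_def)
      then show "\<Lambda> = \<Lambda>'" using split[of \<Lambda>] split[of \<Lambda>'] by metis
    qed simp
    show "f \<Lambda> \<in> (SIGMA p:D. parts_in A J (snd p))" if \<Lambda>: "\<Lambda> \<in> parts_in A (insert x J) \<gamma>" for \<Lambda>
    proof -
      have 1: "set_mset (filter_mset ((\<noteq>) x) \<Lambda>) \<subseteq> totally_positive"
        "set_mset (filter_mset ((\<noteq>) x) \<Lambda>) \<subseteq> J" "count \<Lambda> x \<in> A"
        using \<Lambda> by (auto simp: parts_in_def partitions_def)
      have 2: "\<gamma> = of_nat (count \<Lambda> x) * x + sum_mset (filter_mset ((\<noteq>) x) \<Lambda>)"
        using \<Lambda> arg_cong[OF split[of \<Lambda>], of sum_mset] by (simp add: parts_in_def partitions_def)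
      have 3: "count (filter_mset ((\<noteq>) x) \<Lambda>) y \<in> A" for y
        using \<Lambda> x(3) by (auto simp: parts_in_def)
      have "fst (f \<Lambda>) \<in> decompositions \<gamma>"
        unfolding f_def fst_conv decompositions_iff
        using 2 of_nat_mult_cone[of x] x(1) sum_mset_cone[of "filter_mset ((\<noteq>) x) \<Lambda>"] 1(1) by blast
      then show ?thesis using 1 3 by (auto simp: D_def f_def parts_in_def partitions_def)
    qed
    show "\<exists>\<Lambda>\<in>parts_in A (insert x J) \<gamma>. p = f \<Lambda>" if p: "p \<in> (SIGMA p:D. parts_in A J (snd p))" for p
    proof -
      obtain \<alpha> \<beta> \<Omega> where p_eq: "p = ((\<alpha>, \<beta>), \<Omega>)" by (metis surj_pair)
      obtain n where n: "n \<in> A" "\<alpha> = of_nat n * x" using p p_eq by (auto simp: D_def)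
      have \<Omega>: "\<Omega> \<in> parts_in A J \<beta>" and \<gamma>: "\<gamma> = \<alpha> + \<beta>"
        using p p_eq by (auto simp: D_def decompositions_iff)
      have nx: "count \<Omega> x = 0"
        using \<Omega> x(2) by (auto simp: parts_in_def count_eq_zero_iff)
      let ?\<Lambda> = "replicate_mset n x + \<Omega>"
      have cnt: "count ?\<Lambda> y = (if y = x then n else count \<Omega> y)" for y
        using nx by auto
      have rm: "filter_mset ((\<noteq>) x) ?\<Lambda> = \<Omega>"
        by (rule multiset_eqI) (use nx in \<open>auto simp: cnt\<close>)
      have "?\<Lambda> \<in> parts_in A (insert x J) \<gamma>"
        unfolding parts_in_def cnt using \<Omega> n x(1) \<gamma> nx
        by (auto simp: parts_in_def partitions_def split: if_splits)
      moreover have "p = f ?\<Lambda>"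
        using \<Omega> n(2) by (simp only: f_def rm cnt p_eq) (simp add: parts_in_def partitions_def)
      ultimately show ?thesis by blast
    qed
  qed
  finally show ?thesis by simp
qed

lemma finprod_geom:
  assumes "finite J" "J \<subseteq> totally_positive" "0 \<in> A"
  shows "(\<Otimes>\<^bsub>qsum_ring\<^esub>x\<in>J. geom A x) = (\<lambda>\<gamma>. real (card (parts_in A J \<gamma>)))"
proof -
  interpret comm_monoid "qsum_ring :: ('k \<Rightarrow> real) ring" by (rule qsum_comm_monoid)
  show ?thesis using assms(1,2)
  proof (induction J)
    case empty
    have "parts_in A {} \<gamma> = (if \<gamma> = 0 then {{#}} else {})" for \<gamma>
      using assms(3) by (auto simp: parts_in_def partitions_def)
    then show ?case by (auto simp: qsum_one fun_eq_iff)
  next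
    case (insert x J)
    have "(\<Otimes>\<^bsub>qsum_ring\<^esub>x\<in>insert x J. geom A x) = geom A x \<otimes>\<^bsub>qsum_ring\<^esub> (\<Otimes>\<^bsub>qsum_ring\<^esub>x\<in>J. geom A x)"
      using insert geom_carrier by (intro finprod_insert) auto
    also have "\<dots> = geom A x \<otimes>\<^bsub>qsum_ring\<^esub> (\<lambda>\<gamma>. real (card (parts_in A J \<gamma>)))"
      using insert by simp
    also have "\<dots> = (\<lambda>\<gamma>. real (card (parts_in A (insert x J) \<gamma>)))"
    proof
      fix \<gamma>
      show "(geom A x \<otimes>\<^bsub>qsum_ring\<^esub> (\<lambda>\<gamma>. real (card (parts_in A J \<gamma>)))) \<gamma>
        = real (card (parts_in A (insert x J) \<gamma>))"
        unfolding qsum_mult using insert.prems insert.hyps(2) assms(3)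
        by (subst parts_in_insert) (auto simp: geom_def intro!: sum.cong)
    qed
    finally show ?case .
  qed
qed

text \<open>
  The factors that matter for the coefficient of \<open>q\<^sup>\<gamma>\<close> are those indexed by possible parts of \<open>\<gamma>\<close>.
\<close>

lemma has_qprod_geom:
  assumes H: "H \<subseteq> totally_positive" and A: "0 \<in> A" and f: "\<And>x. x \<in> H \<Longrightarrow> f x = geom A x"
  shows "has_qprod f H (\<lambda>\<gamma>. real (card (parts_in A H \<gamma>)))"
  unfolding has_qprod_def
proof (intro conjI ballI)
  show "(\<lambda>\<gamma>. real (card (parts_in A H \<gamma>))) \<in> carrier qsum_ring"
    unfolding qsum_carrier
  proof (intro allI impI)
    fix \<gamma> :: 'k assume "\<gamma> \<notin> cone"
    then have "\<Lambda> \<notin> parts_in A H \<gamma>" for \<Lambda>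
      using sum_mset_cone[of \<Lambda>] unfolding parts_in_def partitions_def by blast
    then have "parts_in A H \<gamma> = {}" by blast
    then show "real (card (parts_in A H \<gamma>)) = 0" by simp
  qed
  fix \<gamma> :: 'k
  let ?I = "fst ` decompositions \<gamma> \<inter> H"
  have eq: "(\<Otimes>\<^bsub>qsum_ring\<^esub>x\<in>J. f x) \<gamma> = real (card (parts_in A H \<gamma>))"
    if "finite J" "?I \<subseteq> J" "J \<subseteq> H" for J
  proof -
    interpret comm_monoid "qsum_ring :: ('k \<Rightarrow> real) ring" by (rule qsum_comm_monoid)
    have "parts_in A J \<gamma> = parts_in A H \<gamma>"
    proof -
      have "set_mset \<Lambda> \<subseteq> J \<longleftrightarrow> set_mset \<Lambda> \<subseteq> H" if "\<Lambda> \<in> partitions \<gamma>" for \<Lambda>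
        using part_decomposition[OF that] \<open>?I \<subseteq> J\<close> \<open>J \<subseteq> H\<close> by blast
      then show ?thesis unfolding parts_in_def by blast
    qed
    moreover have "(\<Otimes>\<^bsub>qsum_ring\<^esub>x\<in>J. f x) = (\<Otimes>\<^bsub>qsum_ring\<^esub>x\<in>J. geom A x)"
      using that H f geom_carrier by (intro finprod_cong') auto
    ultimately show ?thesis using finprod_geom[of J A] that H A by simp
  qed
  show "\<exists>I. finite I \<and> I \<subseteq> H \<and> (\<Otimes>\<^bsub>qsum_ring\<^esub>i\<in>I. f i) \<gamma> = real (card (parts_in A H \<gamma>)) \<and>
    (\<forall>J. finite J \<and> I \<subseteq> J \<and> J \<subseteq> H \<longrightarrow>
      (\<Otimes>\<^bsub>qsum_ring\<^esub>i\<in>J. f i) \<gamma> = (\<Otimes>\<^bsub>qsum_ring\<^esub>i\<in>I. f i) \<gamma>)"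
    by (intro exI[of _ ?I]) (simp add: eq)
qed

end

section \<open>Base-\<open>d\<close> expansion of multiplicities\<close>

lemma base_digits_sum:
  fixes d n :: nat
  assumes "n < d ^ N"
  shows "(\<Sum>j<N. d ^ j * (n div d ^ j mod d)) = n"
  using assms
proof (induction N arbitrary: n)
  case (Suc N)
  have "n div d < d ^ N"
    using Suc.prems by (simp add: less_mult_imp_div_less mult.commute)
  then have "(\<Sum>j<N. d ^ j * (n div d div d ^ j mod d)) = n div d" by (rule Suc.IH)
  moreover have "(\<Sum>j<Suc N. d ^ j * (n div d ^ j mod d))
    = n mod d + d * (\<Sum>j<N. d ^ j * (n div d div d ^ j mod d))"
    by (subst sum.lessThan_Suc_shift) (simp add: sum_distrib_left mult_ac div_mult2_eq)
  ultimately show ?case by simp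
qed auto

lemma base_digits_unique:
  fixes d :: nat
  assumes "\<And>j. b j < d" "\<And>j. c j < d" "(\<Sum>j<N. d ^ j * b j) = (\<Sum>j<N. d ^ j * c j)" "i < N"
  shows "b i = c i"
  using assms
proof (induction N arbitrary: b c i)
  case (Suc N)
  have split: "(\<Sum>j<Suc N. d ^ j * f j) = f 0 + d * (\<Sum>j<N. d ^ j * f (Suc j))" for f
    by (subst sum.lessThan_Suc_shift) (simp add: sum_distrib_left mult_ac)
  have eq: "b 0 + d * (\<Sum>j<N. d ^ j * b (Suc j)) = c 0 + d * (\<Sum>j<N. d ^ j * c (Suc j))"
    using Suc.prems(3) unfolding split .
  have d: "d > 0" using Suc.prems(1) by (metis gr_implies_not0 neq0_conv)
  have 0: "b 0 = c 0" using arg_cong[OF eq, of "\<lambda>t. t mod d"] Suc.prems(1,2) by simp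
  with eq d have "(\<Sum>j<N. d ^ j * b (Suc j)) = (\<Sum>j<N. d ^ j * c (Suc j))" by simp
  then have "b (Suc j) = c (Suc j)" if "j < N" for j
    using Suc.IH[of "\<lambda>j. b (Suc j)" "\<lambda>j. c (Suc j)" j] Suc.prems(1,2) that by blast
  with 0 Suc.prems(4) show ?case by (cases i) auto
qed auto

text \<open>
  The injectivity assumption says that the sets \<open>d\<^sup>j H\<close> are pairwise disjoint copies of \<open>H\<close>, so that a
  part of the form \<open>d\<^sup>j y\<close> determines both \<open>j\<close> and \<open>y\<close>.
\<close>

locale digit_shifts =
  fixes H :: "'a::comm_semiring_1 set" and d :: nat
  assumes d_ge_2: "d \<ge> 2"
    and shift_inj: "\<And>i j y y'. y \<in> H \<Longrightarrow> y' \<in> H \<Longrightarrow> of_nat d ^ i * y = of_nat d ^ j * y' \<Longrightarrow> i = j \<and> y = y'"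
begin

abbreviation shift :: "nat \<Rightarrow> 'a \<Rightarrow> 'a" where "shift j y \<equiv> of_nat d ^ j * y"

definition shifts :: "'a set" where "shifts = {shift j y | j y. y \<in> H}"

definition split_part :: "'a \<Rightarrow> 'a multiset" where
  "split_part x = (SOME \<Lambda>. \<exists>j. \<exists>y\<in>H. x = shift j y \<and> \<Lambda> = replicate_mset (d ^ j) y)"

text \<open>
  The inverse of the base-\<open>d\<close> expansion, which needs no choice of digits: each part \<open>d\<^sup>j y\<close> is broken
  into \<open>d\<^sup>j\<close> copies of \<open>y\<close>.
\<close>

definition split_parts :: "'a multiset \<Rightarrow> 'a multiset" where
  "split_parts \<Lambda> = (\<Sum>x\<in>#\<Lambda>. split_part x)"

lemma split_part_shift: "y \<in> H \<Longrightarrow> split_part (shift j y) = replicate_mset (d ^ j) y"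
  unfolding split_part_def by (rule some_equality) (use shift_inj in blast)+

lemma sum_split_parts: "set_mset \<Lambda> \<subseteq> shifts \<Longrightarrow> sum_mset (split_parts \<Lambda>) = sum_mset \<Lambda>"
  by (induction \<Lambda>) (auto simp: split_parts_def shifts_def split_part_shift)

lemma set_split_parts: "set_mset \<Lambda> \<subseteq> shifts \<Longrightarrow> set_mset (split_parts \<Lambda>) \<subseteq> H"
  by (induction \<Lambda>) (auto simp: split_parts_def shifts_def split_part_shift split: if_splits)

text \<open>
  The multiplicities of the shifts of \<open>y\<close> are the base-\<open>d\<close> digits of the resulting multiplicity of
  \<open>y\<close>, provided that they are smaller than \<open>d\<close>. So injectivity of \<open>split_parts\<close> on multisets with small
  multiplicities is the uniqueness of digits, and surjectivity is their existence.
\<close>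

lemma count_split_parts:
  assumes "set_mset \<Lambda> \<subseteq> {shift j y | j y. j < N \<and> y \<in> H}" "y \<in> H"
  shows "count (split_parts \<Lambda>) y = (\<Sum>j<N. d ^ j * count \<Lambda> (shift j y))"
  using assms(1)
proof (induction \<Lambda>)
  case (add x \<Lambda>)
  then obtain i z where iz: "i < N" "z \<in> H" "x = shift i z" by auto
  have "(\<Sum>j<N. d ^ j * count (add_mset x \<Lambda>) (shift j y))
    = (\<Sum>j<N. (if j = i \<and> z = y then d ^ j else 0) + d ^ j * count \<Lambda> (shift j y))"
  proof (rule sum.cong[OF refl])
    fix j
    have "x = shift j y \<longleftrightarrow> j = i \<and> z = y" using shift_inj[OF iz(2) assms(2), of i j] iz(3) by auto
    then show "d ^ j * count (add_mset x \<Lambda>) (shift j y)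
      = (if j = i \<and> z = y then d ^ j else 0) + d ^ j * count \<Lambda> (shift j y)" by auto
  qed
  also have "\<dots> = (if z = y then d ^ i else 0) + (\<Sum>j<N. d ^ j * count \<Lambda> (shift j y))"
    using iz(1) by (cases "z = y") (simp_all add: sum.distrib)
  also have "\<dots> = count (split_part x) y + count (split_parts \<Lambda>) y"
    using add by (simp add: iz(2,3) split_part_shift)
  finally show ?case by (simp add: split_parts_def)
qed (simp add: split_parts_def)

lemma bounded_shift:
  assumes "set_mset \<Lambda> \<subseteq> shifts"
  obtains N where "\<And>M. N \<le> M \<Longrightarrow> set_mset \<Lambda> \<subseteq> {shift j y | j y. j < M \<and> y \<in> H}"
proof -
  have "\<exists>N. \<forall>M\<ge>N. set_mset \<Lambda> \<subseteq> {shift j y | j y. j < M \<and> y \<in> H}"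
    using assms
  proof (induction \<Lambda>)
    case (add x \<Lambda>)
    then obtain N i z where N: "\<forall>M\<ge>N. set_mset \<Lambda> \<subseteq> {shift j y | j y. j < M \<and> y \<in> H}"
      and iz: "z \<in> H" "x = shift i z" by (auto simp: shifts_def)
    show ?case
      using N iz by (intro exI[of _ "max N (Suc i)"]) fastforce
  qed auto
  then show thesis using that by blast
qed

lemma split_parts_inj:
  assumes "set_mset \<Lambda> \<subseteq> shifts" "set_mset \<Lambda>' \<subseteq> shifts" "\<And>x. count \<Lambda> x < d" "\<And>x. count \<Lambda>' x < d"
    and eq: "split_parts \<Lambda> = split_parts \<Lambda>'"
  shows "\<Lambda> = \<Lambda>'"
proof (rule multiset_eqI)
  fix x
  show "count \<Lambda> x = count \<Lambda>' x"
  proof (cases "x \<in> shifts")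
    case True
    then obtain i y where iy: "y \<in> H" "x = shift i y" by (auto simp: shifts_def)
    obtain N where N: "\<And>M. N \<le> M \<Longrightarrow> set_mset \<Lambda> \<subseteq> {shift j y | j y. j < M \<and> y \<in> H}"
      using bounded_shift[OF assms(1)] by blast
    obtain N' where N': "\<And>M. N' \<le> M \<Longrightarrow> set_mset \<Lambda>' \<subseteq> {shift j y | j y. j < M \<and> y \<in> H}"
      using bounded_shift[OF assms(2)] by blast
    define M where "M = max (Suc i) (max N N')"
    have "(\<Sum>j<M. d ^ j * count \<Lambda> (shift j y)) = (\<Sum>j<M. d ^ j * count \<Lambda>' (shift j y))"
      using count_split_parts[OF N[of M] iy(1)] count_split_parts[OF N'[of M] iy(1)] eq
      by (simp add: M_def)
    then have "count \<Lambda> (shift i y) = count \<Lambda>' (shift i y)"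
      by (rule base_digits_unique[OF assms(3,4)]) (simp add: M_def)
    then show ?thesis by (simp add: iy(2))
  next
    case False
    then have "x \<notin># \<Lambda>" "x \<notin># \<Lambda>'" using assms(1,2) by auto
    then show ?thesis by (simp add: not_in_iff)
  qed
qed

lemma split_parts_surj:
  assumes "set_mset \<Omega> \<subseteq> H"
  obtains \<Lambda> where "set_mset \<Lambda> \<subseteq> shifts" "\<And>x. count \<Lambda> x < d" "split_parts \<Lambda> = \<Omega>"
proof -
  define N where "N = size \<Omega>"
  define dig where "dig p = count \<Omega> (snd p) div d ^ fst p mod d" for p :: "nat \<times> 'a"
  define A where "A = {..<N} \<times> set_mset \<Omega>"
  define \<Lambda> where "\<Lambda> = (\<Sum>p\<in>A. replicate_mset (dig p) (shift (fst p) (snd p)))"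
  have fin: "finite A" by (simp add: A_def)
  have small: "count \<Omega> y < d ^ N" for y
  proof -
    \<comment> \<open>The size of \<open>\<Omega>\<close> bounds the number of digits that any multiplicity in it can have.\<close>
    have "count \<Omega> y \<le> N" unfolding N_def by (rule count_le_size)
    also have "N < 2 ^ N" by simp
    also have "\<dots> \<le> d ^ N" using d_ge_2 by (simp add: power_mono)
    finally show ?thesis .
  qed
  have supp: "set_mset \<Lambda> \<subseteq> {shift j y | j y. j < N \<and> y \<in> H}"
    using assms fin by (fastforce simp: \<Lambda>_def A_def set_mset_sum split: if_splits)
  have count: "count \<Lambda> (shift i y) = dig (i, y)" if "i < N" "y \<in> H" for i y
  proof -
    have "count \<Lambda> (shift i y) = (\<Sum>p\<in>A. if p = (i, y) then dig p else 0)"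
      unfolding \<Lambda>_def count_sum
    proof (rule sum.cong[OF refl])
      fix p assume "p \<in> A"
      then have "snd p \<in> H" using assms by (auto simp: A_def)
      then have "shift (fst p) (snd p) = shift i y \<longleftrightarrow> p = (i, y)"
        using shift_inj[of "snd p" y "fst p" i] that(2) by (cases p) auto
      then show "count (replicate_mset (dig p) (shift (fst p) (snd p))) (shift i y)
        = (if p = (i, y) then dig p else 0)" by (cases "p = (i, y)") auto
    qed
    also have "\<dots> = (if (i, y) \<in> A then dig (i, y) else 0)" using fin by simp
    also have "\<dots> = dig (i, y)"
      using that(1) by (auto simp: A_def dig_def not_in_iff)
    finally show ?thesis .
  qed
  show thesis
  proof
    show S: "set_mset \<Lambda> \<subseteq> shifts" using supp unfolding shifts_def by blast
    show "count \<Lambda> x < d" for x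
    proof (cases "x \<in># \<Lambda>")
      case True
      then obtain i y where "i < N" "y \<in> H" "x = shift i y" using supp by auto
      then show ?thesis using count d_ge_2 by (simp add: dig_def)
    qed (use d_ge_2 in \<open>simp add: not_in_iff\<close>)
    show "split_parts \<Lambda> = \<Omega>"
    proof (rule multiset_eqI)
      fix y
      show "count (split_parts \<Lambda>) y = count \<Omega> y"
      proof (cases "y \<in> H")
        case True
        have "count (split_parts \<Lambda>) y = (\<Sum>j<N. d ^ j * (count \<Omega> y div d ^ j mod d))"
          by (subst count_split_parts[OF supp True], rule sum.cong)
            (use True in \<open>auto simp: count dig_def\<close>)
        also have "\<dots> = count \<Omega> y" by (rule base_digits_sum[OF small])
        finally show ?thesis .
      next
        case False
        then have "y \<notin># \<Omega>" "y \<notin># split_parts \<Lambda>" using assms set_split_parts[OF S] by auto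
        then show ?thesis by (simp add: not_in_iff)
      qed
    qed
  qed
qed

lemma card_bounded_multiplicity:
  "card {\<Lambda>. set_mset \<Lambda> \<subseteq> shifts \<and> (\<forall>x. count \<Lambda> x < d) \<and> sum_mset \<Lambda> = \<gamma>}
    = card {\<Omega>. set_mset \<Omega> \<subseteq> H \<and> sum_mset \<Omega> = \<gamma>}" (is "card ?A = card ?B")
proof (rule bij_betw_same_card)
  show "bij_betw split_parts ?A ?B"
    unfolding bij_betw_def
  proof
    show "inj_on split_parts ?A" by (auto intro!: inj_onI split_parts_inj)
    show "split_parts ` ?A = ?B"
    proof
      show "split_parts ` ?A \<subseteq> ?B" using set_split_parts sum_split_parts by auto
      show "?B \<subseteq> split_parts ` ?A"
      proof
        fix \<Omega> assume \<Omega>: "\<Omega> \<in> ?B"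
        then obtain \<Lambda> where "set_mset \<Lambda> \<subseteq> shifts" "\<And>x. count \<Lambda> x < d" "split_parts \<Lambda> = \<Omega>"
          using split_parts_surj[of \<Omega>] by blast
        with \<Omega> show "\<Omega> \<in> split_parts ` ?A"
          using sum_split_parts[of \<Lambda>] by (intro image_eqI[of _ _ \<Lambda>]) auto
      qed
    qed
  qed
qed

end

section \<open>Splitting off powers of \<open>d\<close>\<close>

context totally_real_field
begin

lemma of_nat_power_integers: "of_nat d ^ j \<in> integers"
  using algebraic_int_of_nat[of "d ^ j"] by (simp del: algebraic_int_of_nat)

lemma shift_totally_positive_iff:
  assumes "d > 0" "algebraic_int (y::'k)"
  shows "of_nat d ^ j * y \<in> totally_positive \<longleftrightarrow> y \<in> totally_positive"
proof -
  have eq: "\<sigma> (of_nat d ^ j * y) = of_nat d ^ j * \<sigma> y" if "\<sigma> \<in> embeddings" for \<sigma> :: "'k \<Rightarrow> real"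
    using that embedding_of_nat[OF that, of "d ^ j"] by (simp add: embeddings_iff)
  have "0 < \<sigma> (of_nat d ^ j * y) \<longleftrightarrow> 0 < \<sigma> y" if "\<sigma> \<in> embeddings" for \<sigma> :: "'k \<Rightarrow> real"
    unfolding eq[OF that] using assms(1) by (simp add: zero_less_mult_iff)
  then show ?thesis
    using assms(2) integers_closed(2)[OF of_nat_power_integers[of d j], of y] by (auto simp: totally_positive_iff)
qed

text \<open>
  If \<open>y = x / d\<^sup>j\<close> is integral, then \<open>x = y + (d\<^sup>j - 1) y\<close> is a decomposition of \<open>x\<close>. Distinct exponents
  give distinct \<open>y\<close>, and \<open>x\<close> has only finitely many decompositions.
\<close>

lemma finite_divisor_exponents:
  assumes d: "d \<ge> 2" and x: "x \<in> totally_positive"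
  shows "finite {j. \<exists>y::'k. algebraic_int y \<and> x = of_nat d ^ j * y}" (is "finite ?E")
proof -
  define q where "q j = x / of_nat d ^ j" for j
  have x0: "x \<noteq> 0" using x zero_not_totally_positive by auto
  have d0: "of_nat d ^ j \<noteq> (0::'k)" for j using d by simp
  have "q ` ?E \<subseteq> fst ` decompositions x"
  proof (rule image_subsetI)
    fix j assume "j \<in> ?E"
    then obtain y where y: "algebraic_int y" "x = of_nat d ^ j * y" by blast
    have "y \<in> cone" using x y d shift_totally_positive_iff[of d y j] by simp
    moreover from this have "of_nat (d ^ j - 1) * y \<in> cone" by (rule of_nat_mult_cone)
    moreover have "x = y + of_nat (d ^ j - 1) * y"
      using d by (simp add: y(2) of_nat_diff algebra_simps)
    ultimately have "(y, of_nat (d ^ j - 1) * y) \<in> decompositions x"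
      unfolding decompositions_iff by blast
    moreover have "q j = y" using d0 by (simp add: q_def y(2))
    ultimately show "q j \<in> fst ` decompositions x" by force
  qed
  moreover have "inj_on q ?E"
  proof (rule inj_onI)
    fix i j assume "q i = q j"
    then have "(of_nat d :: 'k) ^ i = of_nat d ^ j" using x0 d0 by (simp add: q_def field_simps)
    then have "d ^ i = d ^ j" by (metis of_nat_eq_iff of_nat_power)
    then show "i = j" using d by (simp add: power_inject_exp)
  qed
  ultimately show ?thesis by (meson finite_decompositions finite_imageI finite_imageD finite_subset)
qed

context
  fixes \<aa> :: "'k set" and d :: nat
  assumes ideal: "ideal \<aa> ring_of_integers" and d_in: "of_nat d \<in> \<aa>"
begin

lemma ideal_closed:
  "x \<in> \<aa> \<Longrightarrow> y \<in> \<aa> \<Longrightarrow> x + y \<in> \<aa>" "x \<in> \<aa> \<Longrightarrow> y \<in> integers \<Longrightarrow> x * y \<in> \<aa>"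
  using additive_subgroup.a_closed[OF ideal.axioms(1)[OF ideal], of x y]
    ideal.I_r_closed[OF ideal, of x y]
  by (auto simp: ring_of_integers_def ring_of_type_algebra_def)

lemma principal_power_ideal:
  "PIdl\<^bsub>ring_of_integers\<^esub> (of_nat d ^ j) = {of_nat d ^ j * y | y::'k. y \<in> integers}"
  by (auto simp: cgenideal_def ring_of_integers_def ring_of_type_algebra_def mult.commute)

lemma ideal_times_principal_power:
  "ideal_prod ring_of_integers \<aa> (PIdl\<^bsub>ring_of_integers\<^esub> (of_nat d ^ j)) = {of_nat d ^ j * y | y. y \<in> \<aa>}"
  (is "?L = ?R")
proof
  have mult: "x \<otimes>\<^bsub>ring_of_integers\<^esub> y = x * y" and add: "x \<oplus>\<^bsub>ring_of_integers\<^esub> y = x + y" for x y :: 'k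
    by (simp_all add: ring_of_integers_def ring_of_type_algebra_def)
  show "?L \<subseteq> ?R"
  proof
    fix x assume "x \<in> ?L"
    then show "x \<in> ?R"
    proof induction
      case (prod a b)
      then obtain y where y: "y \<in> integers" "b = of_nat d ^ j * y" unfolding principal_power_ideal by blast
      have "a \<otimes>\<^bsub>ring_of_integers\<^esub> b = of_nat d ^ j * (a * y)" by (simp add: mult y(2) mult_ac)
      then show ?case using ideal_closed(2)[OF prod(1) y(1)] by blast
    next
      case (sum s t)
      then obtain a b where "a \<in> \<aa>" "b \<in> \<aa>" "s = of_nat d ^ j * a" "t = of_nat d ^ j * b" by blast
      then show ?case
        using ideal_closed(1)[of a b]
        by (intro CollectI exI[of _ "a + b"]) (simp add: add distrib_left)
    qed
  qed
  show "?R \<subseteq> ?L"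
  proof
    fix x assume "x \<in> ?R"
    then obtain a where a: "a \<in> \<aa>" "x = of_nat d ^ j * a" by blast
    have "(of_nat d ^ j :: 'k) \<in> PIdl\<^bsub>ring_of_integers\<^esub> (of_nat d ^ j)"
      unfolding principal_power_ideal by (intro CollectI exI[of _ 1]) simp
    from ideal_prod.prod[OF a(1) this, of ring_of_integers] show "x \<in> ?L" by (simp add: mult a(2) mult_ac)
  qed
qed

text \<open>
  If \<open>d\<^sup>i y = d\<^sup>j y'\<close> with \<open>i < j\<close>, then \<open>y\<close> is a multiple of \<open>d \<in> \<aa>\<close>.
\<close>

lemma digit_shifts_outside_ideal:
  assumes "d \<ge> 2"
  shows "digit_shifts (totally_positive - \<aa>) d"
proof
  show "d \<ge> 2" by fact
  have le: "i = j" if y: "y \<in> totally_positive - \<aa>" "y' \<in> totally_positive - \<aa>" "i \<le> j"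
    "of_nat d ^ i * y = of_nat d ^ j * y'" for i j and y y' :: 'k
  proof (rule ccontr)
    assume "i \<noteq> j"
    then obtain k where k: "j = i + Suc k" using \<open>i \<le> j\<close>
      by (metis add_Suc_right le_neq_implies_less less_imp_Suc_add)
    have "y = of_nat d * (of_nat d ^ k * y')"
      using y(4) assms by (simp add: k power_add mult_ac)
    moreover have "of_nat d ^ k * y' \<in> integers"
      using integers_closed(2)[OF of_nat_power_integers] y(2) by (simp add: totally_positive_iff)
    ultimately have "y \<in> \<aa>" using ideal_closed(2)[OF d_in] by simp
    with y(1) show False by simp
  qed
  fix i j and y y' :: 'k
  assume y: "y \<in> totally_positive - \<aa>" "y' \<in> totally_positive - \<aa>" and eq: "of_nat d ^ i * y = of_nat d ^ j * y'"
  have "i = j" using le[OF y _ eq] le[OF y(2,1) _ eq[symmetric]] by (metis nat_le_linear)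
  then show "i = j \<and> y = y'" using eq assms by simp
qed

text \<open>
  Let \<open>x = d\<^sup>i y\<close>. If \<open>y \<notin> \<aa>\<close> and \<open>x \<in> d\<^sup>j \<aa>\<close>, then \<open>j < i\<close>, so \<open>x\<close> is divisible by \<open>d\<^sup>j\<^sup>+\<^sup>1\<close> and is not
  removed. If \<open>i\<close> is the largest possible exponent and \<open>y \<in> \<aa>\<close>, then \<open>x \<in> d\<^sup>i \<aa>\<close> is not divisible by
  \<open>d\<^sup>i\<^sup>+\<^sup>1\<close> and is removed.
\<close>

lemma shifts_outside_ideal:
  assumes d: "d \<ge> 2"
  shows "digit_shifts.shifts (totally_positive - \<aa>) d = totally_positive -
    (\<Union>j::nat. ideal_prod ring_of_integers \<aa> (PIdl\<^bsub>ring_of_integers\<^esub> (of_nat d ^ j))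
       - PIdl\<^bsub>ring_of_integers\<^esub> (of_nat d ^ (j + 1)))" (is "_ = ?S")
proof -
  interpret digit_shifts "totally_positive - \<aa>" d by (rule digit_shifts_outside_ideal[OF d])
  have mem: "x \<in> ?S \<longleftrightarrow> x \<in> totally_positive \<and>
    (\<forall>j. \<forall>a\<in>\<aa>. x = of_nat d ^ j * a \<longrightarrow> (\<exists>y\<in>integers. x = of_nat d ^ Suc j * y))" for x
    unfolding ideal_times_principal_power unfolding principal_power_ideal Suc_eq_plus1 by blast
  show "shifts = ?S"
  proof (intro equalityI subsetI)
    fix x assume "x \<in> shifts"
    then obtain i y where y: "x = of_nat d ^ i * y" "y \<in> totally_positive" "y \<notin> \<aa>"
      by (auto simp: shifts_def)
    have yO: "y \<in> integers" using y(2) by (simp add: totally_positive_iff)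
    show "x \<in> ?S"
      unfolding mem
    proof (intro conjI allI ballI impI)
      show "x \<in> totally_positive" using y yO d shift_totally_positive_iff[of d y i] by simp
      fix j a assume a: "a \<in> \<aa>" "x = of_nat d ^ j * a"
      have "j < i"
      proof (rule ccontr)
        assume "\<not> j < i"
        then have "of_nat d ^ j = (of_nat d ^ i * of_nat d ^ (j - i) :: 'k)"
          by (simp flip: power_add)
        then have "y = a * of_nat d ^ (j - i)" using a(2) y(1) d by (simp add: mult_ac)
        then show False using ideal_closed(2)[OF a(1) of_nat_power_integers] y(3) by simp
      qed
      then have "of_nat d ^ i = (of_nat d ^ Suc j * of_nat d ^ (i - Suc j) :: 'k)"
        by (simp flip: power_add power_Suc)
      then have "x = of_nat d ^ Suc j * (of_nat d ^ (i - Suc j) * y)"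
        using y(1) by (simp add: mult_ac)
      then show "\<exists>y\<in>integers. x = of_nat d ^ Suc j * y"
        using integers_closed(2)[OF of_nat_power_integers yO] by blast
    qed
  next
    fix x assume x: "x \<in> ?S"
    define E where "E = {j. \<exists>y::'k. algebraic_int y \<and> x = of_nat d ^ j * y}"
    have xt: "x \<in> totally_positive" using x by blast
    have fin: "finite E" unfolding E_def by (rule finite_divisor_exponents[OF d xt])
    have "0 \<in> E" using xt by (auto simp: E_def totally_positive_iff)
    define m where "m = Max E"
    have "m \<in> E" unfolding m_def using fin \<open>0 \<in> E\<close> by (intro Max_in) auto
    then obtain y where y: "algebraic_int y" "x = of_nat d ^ m * y" by (auto simp: E_def)
    have "Suc m \<notin> E"
      using Max_ge[OF fin, of "Suc m"] by (auto simp: m_def)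
    then have "y \<notin> \<aa>" using x y(2) unfolding mem E_def by blast
    moreover have "y \<in> totally_positive" using shift_totally_positive_iff[of d y m] xt y d by simp
    ultimately show "x \<in> shifts" unfolding shifts_def using y(2) by blast
  qed
qed

end

text \<open>
  For \<open>d = 1\<close> the powers of \<open>d\<close> do not separate parts, but both sides then only allow the empty
  partition.
\<close>

lemma card_parts_eq:
  assumes "ideal \<aa> ring_of_integers" "d > 0" "of_nat d \<in> \<aa>"
    and S: "S = totally_positive -
           (\<Union>j::nat. ideal_prod ring_of_integers \<aa> (PIdl\<^bsub>ring_of_integers\<^esub> (of_nat d ^ j))
                       - PIdl\<^bsub>ring_of_integers\<^esub> (of_nat d ^ (j + 1)))"
  shows "card (parts_in UNIV (totally_positive - \<aa>) \<gamma>) = card (parts_in {..d - 1} S (\<gamma>::'k))"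
proof (cases "d = 1")
  case True
  have "totally_positive \<subseteq> \<aa>"
    using ideal_closed(2)[OF assms(1,3), of 1] True assms(3) by (auto simp: totally_positive_iff)
  then have empty: "totally_positive - \<aa> = {}" by blast
  have "parts_in UNIV (totally_positive - \<aa>) \<gamma> = (if \<gamma> = 0 then {{#}} else {})"
    by (auto simp: empty parts_in_def partitions_def)
  moreover have "(\<forall>x. count \<Lambda> x \<in> {..d - 1}) \<longleftrightarrow> \<Lambda> = {#}" for \<Lambda> :: "'k multiset"
    using True by (auto intro: multiset_eqI)
  then have "parts_in {..d - 1} S \<gamma> = (if \<gamma> = 0 then {{#}} else {})"
    by (auto simp: parts_in_def partitions_def simp del: atMost_iff)
  ultimately show ?thesis by simp
next
  case False
  then have d: "d \<ge> 2" using assms(2) by linarith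
  interpret digit_shifts "totally_positive - \<aa>" d
    by (rule digit_shifts_outside_ideal[OF assms(1,3) d])
  have S_eq: "S = shifts" unfolding S by (rule shifts_outside_ideal[OF assms(1,3) d, symmetric])
  have "parts_in UNIV (totally_positive - \<aa>) \<gamma>
    = {\<Lambda>. set_mset \<Lambda> \<subseteq> totally_positive - \<aa> \<and> sum_mset \<Lambda> = \<gamma>}"
    unfolding parts_in_def partitions_def by blast
  moreover have "count \<Lambda> x \<in> {..d - 1} \<longleftrightarrow> count \<Lambda> x < d" for \<Lambda> and x :: 'k
    using d by auto
  then have "parts_in {..d - 1} S \<gamma> = {\<Lambda>. set_mset \<Lambda> \<subseteq> shifts \<and> (\<forall>x. count \<Lambda> x < d) \<and> sum_mset \<Lambda> = \<gamma>}"
    using S unfolding S_eq parts_in_def partitions_def by blast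
  ultimately show ?thesis using card_bounded_multiplicity[of \<gamma>] by simp
qed

end

theorem theorem4p1:
  fixes \<aa> S :: "'k::field_char_0 set" and d :: nat
  assumes "number_field TYPE('k)"
    and "totally_real TYPE('k)"
    and "ideal \<aa> ring_of_integers"
    and "d > 0"
    and "of_nat d \<in> \<aa>"
    and "S = totally_positive -
           (\<Union>j::nat. ideal_prod ring_of_integers \<aa> (PIdl\<^bsub>ring_of_integers\<^esub> (of_nat d ^ j))
                       - PIdl\<^bsub>ring_of_integers\<^esub> (of_nat d ^ (j + 1)))"
  shows "(\<exists>F. has_qprod q_geom {\<delta> \<in> totally_positive. \<delta> \<notin> \<aa>} F \<and>
              has_qprod (q_geom_upto (d - 1)) S F) \<and>
         (\<forall>\<delta> \<in> totally_positive.
            num_partitions (totally_positive - \<aa>) \<delta> = num_partitions_le S (d - 1) \<delta>)"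
proof -
  interpret totally_real_field "TYPE('k)"
    by (rule totally_real_field.intro[OF assms(1,2) ideal.axioms(2)[OF assms(3)]])
  note card_eq = card_parts_eq[OF assms(3-6)]
  have S: "S \<subseteq> totally_positive" unfolding assms(6) by blast
  have H: "{\<delta> \<in> totally_positive. \<delta> \<notin> \<aa>} = totally_positive - \<aa>" by blast
  have "has_qprod q_geom (totally_positive - \<aa>) (\<lambda>\<gamma>. real (card (parts_in UNIV (totally_positive - \<aa>) \<gamma>)))"
    by (rule has_qprod_geom) (auto simp: q_geom_eq)
  moreover have "has_qprod (q_geom_upto (d - 1)) S (\<lambda>\<gamma>. real (card (parts_in {..d - 1} S \<gamma>)))"
    by (rule has_qprod_geom[OF S]) (use S q_geom_upto_eq in auto)
  moreover have "num_partitions (totally_positive - \<aa>) \<delta> = num_partitions_le S (d - 1) \<delta>" for \<delta>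
    using card_eq[of \<delta>] by (simp add: num_partitions_def num_partitions_le_def parts_in_def)
  ultimately show ?thesis unfolding H card_eq by blast
qed

end
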